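(* Let $L = E_8 \subseteq \mathbb{R}^8$. Then for every $\alpha \geq 23$, the deep holes of $L$ are the unique minimizers of the function $z \mapsto p(f_\alpha, L, z) = \sum_{x \in L} e^{-\alpha\|x-z\|^2}$ over $\mathbb{R}^8$; that is, the set of minimizers equals the set of deep holes of $L$.
   Context: $E_8 = D_8 \cup (\tfrac12 e + D_8)$, where $D_8 = \{x \in \mathbb{Z}^8 : \sum_i x_i \equiv 0 \pmod 2\}$ and $e = (1,\dots,1)$. A deep hole of $L \subseteq \mathbb{R}^n$ is a point $c \in \mathbb{R}^n$ with $\min_{x\in L}\|x-c\| = \max_{z \in \mathbb{R}^n}\min_{x \in L}\|x-z\|$. *)

theory Defs
  imports "HOL-Analysis.Analysis"
begin

definition D8 :: "(real ^ 8) set" where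
  "D8 = {x. \<exists>a :: int ^ 8. (\<forall>i. x $ i = of_int (a $ i)) \<and> even (\<Sum>i\<in>UNIV. a $ i)}"

definition E8 :: "(real ^ 8) set" where
  "E8 = D8 \<union> (\<lambda>x. (1 / 2) *\<^sub>R vec 1 + x) ` D8"

text \<open>For nonempty \<open>L\<close>, \<open>infdist c L\<close> is the infimum of \<open>dist c x\<close> over \<open>x \<in> L\<close>. It is a minimum when
  \<open>L\<close> is also closed; see \<open>infdist_E8_attained\<close> below. That \<open>infdist c L\<close> is the maximum over all \<open>z\<close>
  means precisely that it bounds every \<open>infdist z L\<close>.\<close>

definition deep_hole :: "'a::euclidean_space set \<Rightarrow> 'a \<Rightarrow> bool" where
  "deep_hole L c \<longleftrightarrow> (\<forall>z. infdist z L \<le> infdist c L)"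

text \<open>Potential functions are applied to squared distances.\<close>

definition potential :: "(real \<Rightarrow> real) \<Rightarrow> 'a::euclidean_space set \<Rightarrow> 'a \<Rightarrow> real" where
  "potential f L z = (\<Sum>\<^sub>\<infinity>x\<in>L. f ((norm (x - z))\<^sup>2))"

definition gaussian :: "real \<Rightarrow> real \<Rightarrow> real" where
  "gaussian \<alpha> r = exp (- \<alpha> * r)"

lemma E8_half_integral: "x \<in> E8 \<Longrightarrow> 2 * x $ i \<in> \<int>"
  by (auto simp: E8_def D8_def distrib_left)

lemma closed_E8: "closed E8"
proof (rule discrete_imp_closed[of "1 / 2"])
  show "\<forall>x\<in>E8. \<forall>y\<in>E8. dist y x < 1 / 2 \<longrightarrow> y = x"
  proof (intro ballI impI)
    fix x y assume xy: "x \<in> E8" "y \<in> E8" and d: "dist y x < 1 / 2"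
    have "y $ i = x $ i" for i
    proof -
      have "2 * y $ i - 2 * x $ i \<in> \<int>"
        using xy by (intro Ints_diff E8_half_integral)
      moreover have "\<bar>y $ i - x $ i\<bar> < 1 / 2"
        using d component_le_norm_cart[of "y - x" i] by (simp add: dist_norm)
      then have "\<bar>2 * y $ i - 2 * x $ i\<bar> < 1" by linarith
      ultimately show ?thesis
        using Ints_nonzero_abs_less1 by fastforce
    qed
    then show "y = x" by (simp add: vec_eq_iff)
  qed
qed simp

lemma infdist_E8_attained: "\<exists>x\<in>E8. infdist z E8 = dist z x"
proof -
  have "0 \<in> E8" by (auto simp: E8_def D8_def intro!: exI[of _ 0])
  then show ?thesis using infdist_attains_inf[OF closed_E8, of z] by blast
qed

end

theory Submission
  imports Defs
begin

text \<open>
  Since \<open>E8\<close> has covering radius \<open>1\<close>, every point \<open>z\<close> lies within \<open>1 / 2\<close> of some point of the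
  half-scaled lattice, and modulo \<open>E8\<close> the latter is \<open>0\<close>, half of a root, or half of a vector of
  squared norm \<open>4\<close>. In the first two cases some lattice point has squared distance at most \<open>3 / 4\<close>
  from \<open>z\<close>, and its contribution \<open>exp (- 3 / 4 * \<alpha>)\<close> alone beats the potential of a deep hole, which
  is at most \<open>20 * exp (- \<alpha>)\<close>. In the third case a symmetry of the lattice (reflections in roots act
  transitively) puts \<open>z\<close> at \<open>c + y\<close> with \<open>c\<close> the first unit vector and \<open>norm y \<le> 1 / 2\<close>. The sixteen
  points \<open>c \<plusminus> axis i 1\<close> contribute \<open>2 * exp (- \<alpha> * (1 + (norm y)\<^sup>2))\<close> times the sum of the
  \<open>cosh (2 * \<alpha> * y $ i)\<close>, which by convexity of \<open>t \<mapsto> cosh (sqrt t)\<close> outweighs the loss factor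
  \<open>exp (- \<alpha> * (norm y)\<^sup>2)\<close>; the remaining points lose at most this factor, by symmetry about \<open>c\<close>.
\<close>

section \<open>The lattice and its covering radius\<close>

lemma norm_sq_vec: "(norm (x :: real ^ 'n))\<^sup>2 = (\<Sum>i\<in>UNIV. (x $ i)\<^sup>2)"
  unfolding power2_norm_eq_inner inner_vec_def by (simp add: power2_eq_square)

text \<open>Treats the integral and the half-integral coset uniformly, so that closure and
  integrality need no case split. Any integer \<open>p\<close> may occur: moving
  \<open>p div 2\<close> into all eight coordinates changes their sum by a multiple of 8 and keeps
  its parity.\<close>

lemma E8_iff:
  "x \<in> E8 \<longleftrightarrow> (\<exists>(p :: int) (a :: int ^ 8). (\<forall>i. x $ i = of_int p / 2 + of_int (a $ i)) \<and>
    even (\<Sum>i\<in>UNIV. a $ i))" (is "_ \<longleftrightarrow> ?R")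
proof
  assume "x \<in> E8"
  then consider "x \<in> D8" | y where "y \<in> D8" "x = (1 / 2) *\<^sub>R vec 1 + y"
    by (auto simp: E8_def)
  then show ?R
  proof cases
    case 1
    then obtain a :: "int ^ 8" where "\<forall>i. x $ i = of_int (a $ i)" "even (\<Sum>i\<in>UNIV. a $ i)"
      by (auto simp: D8_def)
    then show ?thesis by (intro exI[of _ 0] exI[of _ a]) auto
  next
    case 2
    then obtain a :: "int ^ 8" where "\<forall>i. y $ i = of_int (a $ i)" "even (\<Sum>i\<in>UNIV. a $ i)"
      by (auto simp: D8_def)
    with 2 show ?thesis by (intro exI[of _ 1] exI[of _ a]) auto
  qed
next
  assume ?R
  then obtain p :: int and a :: "int ^ 8" where x: "\<And>i. x $ i = of_int p / 2 + of_int (a $ i)"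
    and ev: "even (\<Sum>i\<in>UNIV. a $ i)" by blast
  define y :: "real ^ 8" where "y = (\<chi> i. of_int (a $ i + p div 2))"
  have "even (\<Sum>i\<in>(UNIV :: 8 set). a $ i + p div 2)"
    using ev by (simp add: sum.distrib)
  then have y: "y \<in> D8"
    by (auto simp: D8_def y_def intro!: exI[of _ "\<chi> i. a $ i + p div 2"])
  show "x \<in> E8"
  proof (cases "even p")
    case True
    then obtain k where "p = 2 * k" by blast
    then have "x = y" by (simp add: vec_eq_iff x y_def)
    then show ?thesis using y by (simp add: E8_def)
  next
    case False
    then obtain k where "p = 2 * k + 1" using oddE by blast
    then have "x = (1 / 2) *\<^sub>R vec 1 + y" by (simp add: vec_eq_iff x y_def field_simps)
    then show ?thesis using y by (auto simp: E8_def)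
  qed
qed

lemma E8_I:
  assumes "\<And>i. x $ i = of_int p / 2 + of_int (a i)" "even (\<Sum>i\<in>UNIV. a i)"
  shows "x \<in> E8"
  unfolding E8_iff using assms by (intro exI[of _ p] exI[of _ "\<chi> i. a i"]) auto

lemma E8_E:
  assumes "x \<in> E8"
  obtains p :: int and a :: "8 \<Rightarrow> int"
  where "\<And>i. x $ i = of_int p / 2 + of_int (a i)" "even (\<Sum>i\<in>UNIV. a i)"
  using assms unfolding E8_iff by blast

lemma E8_add:
  assumes "x \<in> E8" "y \<in> E8" shows "x + y \<in> E8"
proof -
  obtain p a where a: "\<And>i. x $ i = of_int p / 2 + of_int (a i)" "even (\<Sum>i\<in>UNIV. a i)"
    using E8_E[OF assms(1)] by blast
  obtain q b where b: "\<And>i. y $ i = of_int q / 2 + of_int (b i)" "even (\<Sum>i\<in>UNIV. b i)"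
    using E8_E[OF assms(2)] by blast
  show ?thesis
    using a b by (intro E8_I[of _ "p + q" "\<lambda>i. a i + b i"]) (auto simp: field_simps sum.distrib)
qed

lemma E8_scale:
  assumes "x \<in> E8" shows "of_int k *\<^sub>R x \<in> E8"
proof -
  obtain p a where a: "\<And>i. x $ i = of_int p / 2 + of_int (a i)" "even (\<Sum>i\<in>UNIV. a i)"
    using E8_E[OF assms] by blast
  show ?thesis
    using a by (intro E8_I[of _ "k * p" "\<lambda>i. k * a i"])
      (auto simp: field_simps simp flip: sum_distrib_left)
qed

lemma E8_diff: "x \<in> E8 \<Longrightarrow> y \<in> E8 \<Longrightarrow> x - y \<in> E8"
  using E8_add[of x "- y"] E8_scale[of y "-1"] by simp

lemma E8_axis:
  "axis i 1 + axis j 1 \<in> E8" "axis i 1 - axis j 1 \<in> E8"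
  by (rule E8_I[of _ 0 "\<lambda>k. of_bool (k = i) + of_bool (k = j)"],
      auto simp: axis_def sum.distrib)
     (rule E8_I[of _ 0 "\<lambda>k. of_bool (k = i) - of_bool (k = j)"],
      auto simp: axis_def sum_subtractf)

lemma E8_half: "(\<chi> i. 1 / 2) \<in> E8"
  by (rule E8_I[of _ 1 "\<lambda>_. 0"]) auto

text \<open>In the expanded product the eight copies of \<open>p * q / 4\<close> add up to
  \<open>2 * p * q\<close>, and the even coordinate sums cancel the denominators of the mixed
  terms.\<close>

lemma E8_inner_Ints:
  assumes "x \<in> E8" "y \<in> E8" shows "x \<bullet> y \<in> \<int>"
proof -
  obtain p a where a: "\<And>i. x $ i = of_int p / 2 + of_int (a i)" "even (\<Sum>i\<in>UNIV. a i)"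
    using E8_E[OF assms(1)] by blast
  obtain q b where b: "\<And>i. y $ i = of_int q / 2 + of_int (b i)" "even (\<Sum>i\<in>UNIV. b i)"
    using E8_E[OF assms(2)] by blast
  obtain A B where A: "(\<Sum>i\<in>UNIV. a i) = 2 * A" and B: "(\<Sum>i\<in>UNIV. b i) = 2 * B"
    using a(2) b(2) by blast
  have A': "(\<Sum>i\<in>UNIV. real_of_int (a i)) = 2 * of_int A" "(\<Sum>i\<in>UNIV. real_of_int (b i)) = 2 * of_int B"
    using A B by (simp_all flip: of_int_sum)
  have "x \<bullet> y = (\<Sum>i\<in>UNIV. of_int (p * q) / 4 + of_int p / 2 * of_int (b i) + of_int q / 2 * of_int (a i)
      + of_int (a i * b i))"
    by (simp add: inner_vec_def a b field_simps)
  also have "\<dots> = of_int (2 * p * q + p * B + q * A + (\<Sum>i\<in>UNIV. a i * b i))"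
    unfolding sum.distrib sum_distrib_left[symmetric] A' by simp
  finally show ?thesis by (metis Ints_of_int)
qed

lemma E8_norm_sq_even:
  assumes "x \<in> E8" shows "\<exists>k :: int. (norm x)\<^sup>2 = 2 * of_int k"
proof -
  obtain p a where a: "\<And>i. x $ i = of_int p / 2 + of_int (a i)" "even (\<Sum>i\<in>UNIV. a i)"
    using E8_E[OF assms] by blast
  obtain A where A: "(\<Sum>i\<in>UNIV. a i) = 2 * A" using a(2) by blast
  have A': "(\<Sum>i\<in>UNIV. real_of_int (a i)) = 2 * of_int A"
    using A by (simp flip: of_int_sum)
  have "even (\<Sum>i\<in>UNIV. (a i)\<^sup>2 - a i)"
    by (intro dvd_sum) simp
  then have "even (\<Sum>i\<in>UNIV. (a i)\<^sup>2)"
    using a(2) by (simp add: sum_subtractf)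
  then obtain B where "(\<Sum>i\<in>UNIV. (a i)\<^sup>2) = 2 * B" by blast
  then have B: "(\<Sum>i\<in>UNIV. (real_of_int (a i))\<^sup>2) = 2 * of_int B"
    by (simp flip: of_int_sum of_int_power)
  have "(norm x)\<^sup>2 = (\<Sum>i\<in>UNIV. (of_int p)\<^sup>2 / 4 + of_int p * of_int (a i) + (of_int (a i))\<^sup>2)"
    unfolding norm_sq_vec a by (simp add: power2_eq_square field_simps)
  also have "\<dots> = 2 * of_int (p\<^sup>2 + p * A + B)"
    by (simp add: sum.distrib A' B flip: sum_distrib_left)
  finally show ?thesis by blast
qed

text \<open>If the entries of \<open>n\<close> have an odd sum, entry \<open>j\<close> is moved by
  one towards \<open>z\<close>, which turns its squared error \<open>d\<^sup>2\<close> into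
  \<open>(1 - \<bar>d\<bar>)\<^sup>2\<close>. The hypothesis on \<open>j\<close> makes the added
  \<open>1 - 2 * \<bar>d\<bar>\<close> nonnegative, so the bound also covers an even sum.\<close>

lemma round_D8:
  fixes z :: "real ^ 8" and n :: "8 \<Rightarrow> int"
  assumes j: "\<bar>z $ j - of_int (n j)\<bar> \<le> 1 / 2"
  shows "\<exists>x\<in>D8. (norm (z - x))\<^sup>2 \<le>
    (\<Sum>i\<in>UNIV. (z $ i - of_int (n i))\<^sup>2) + 1 - 2 * \<bar>z $ j - of_int (n j)\<bar>"
proof (cases "even (\<Sum>i\<in>UNIV. n i)")
  case True
  define x :: "real ^ 8" where "x = (\<chi> i. of_int (n i))"
  have "x \<in> D8" using True by (auto simp: D8_def x_def intro!: exI[of _ "\<chi> i. n i"])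
  moreover have "(norm (z - x))\<^sup>2 = (\<Sum>i\<in>UNIV. (z $ i - of_int (n i))\<^sup>2)"
    by (simp add: norm_sq_vec x_def)
  ultimately show ?thesis using j by (intro bexI[of _ x]) auto
next
  case False
  define \<epsilon> :: int where "\<epsilon> = (if z $ j \<ge> of_int (n j) then 1 else -1)"
  define m where "m = n(j := n j + \<epsilon>)"
  define x :: "real ^ 8" where "x = (\<chi> i. of_int (m i))"
  have "(\<Sum>i\<in>UNIV. m i) = m j + (\<Sum>i\<in>UNIV - {j}. m i)"
    by (simp add: sum.remove[of UNIV j])
  also have "(\<Sum>i\<in>UNIV - {j}. m i) = (\<Sum>i\<in>UNIV - {j}. n i)"
    by (simp add: m_def)
  also have "m j + \<dots> = (\<Sum>i\<in>UNIV. n i) + \<epsilon>"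
    by (simp add: m_def sum.remove[of UNIV j])
  finally have "even (\<Sum>i\<in>UNIV. m i)" using False by (simp add: \<epsilon>_def)
  then have "x \<in> D8" by (auto simp: D8_def x_def intro!: exI[of _ "\<chi> i. m i"])
  moreover have "(norm (z - x))\<^sup>2 =
      (\<Sum>i\<in>UNIV. (z $ i - of_int (n i))\<^sup>2) + 1 - 2 * \<bar>z $ j - of_int (n j)\<bar>"
  proof -
    have "(norm (z - x))\<^sup>2 = (z $ j - of_int (m j))\<^sup>2 + (\<Sum>i\<in>UNIV - {j}. (z $ i - of_int (m i))\<^sup>2)"
      by (simp add: norm_sq_vec x_def sum.remove[of UNIV j])
    also have "(\<Sum>i\<in>UNIV - {j}. (z $ i - of_int (m i))\<^sup>2) = (\<Sum>i\<in>UNIV - {j}. (z $ i - of_int (n i))\<^sup>2)"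
      by (simp add: m_def)
    also have "(z $ j - of_int (m j))\<^sup>2 = (z $ j - of_int (n j))\<^sup>2 + 1 - 2 * \<bar>z $ j - of_int (n j)\<bar>"
      by (auto simp: m_def \<epsilon>_def power2_eq_square algebra_simps abs_if)
    finally show ?thesis by (simp add: sum.remove[of UNIV j])
  qed
  ultimately show ?thesis by (intro bexI[of _ x]) auto
qed

text \<open>Here \<open>a i\<close> stands for the distance of a coordinate from the integers and
  \<open>1 / 2 - a i\<close> for its distance from the half-integers. The alternatives say that
  \<open>round_D8\<close>, correcting the coordinate with the largest error, reaches squared
  distance at most 1 in the integral or in the half-integral coset.\<close>

lemma rounding_alternative:
  fixes a :: "8 \<Rightarrow> real"
  assumes m: "0 \<le> m" and M: "M \<le> 1 / 2" and a: "\<And>i. m \<le> a i \<and> a i \<le> M"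
  shows "(\<Sum>i\<in>UNIV. (a i)\<^sup>2) \<le> 2 * M \<or> (\<Sum>i\<in>UNIV. (1 / 2 - a i)\<^sup>2) \<le> 1 - 2 * m"
proof (rule ccontr)
  define S where "S = (\<Sum>i\<in>UNIV. a i)"
  define Q where "Q = (\<Sum>i\<in>UNIV. (a i)\<^sup>2)"
  assume "\<not> ?thesis"
  then have 1: "2 * M < Q" and 2: "1 - 2 * m < (\<Sum>i\<in>UNIV. (1 / 2 - a i)\<^sup>2)"
    by (auto simp: Q_def)
  have "(\<Sum>i\<in>UNIV. (1 / 2 - a i)\<^sup>2) = (\<Sum>i\<in>UNIV. 1 / 4 - a i + (a i)\<^sup>2)"
    by (simp add: power2_eq_square algebra_simps)
  also have "\<dots> = 2 - S + Q" by (simp add: sum.distrib sum_subtractf S_def Q_def)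
  finally have 3: "1 - 2 * m < 2 - S + Q" using 2 by simp
  \<comment> \<open>This bounds \<open>Q\<close> linearly in \<open>S\<close>. Failure of both
    alternatives then bounds \<open>S\<close> from below and from above, and the two bounds are
    incompatible when \<open>0 \<le> M - m \<le> 1 / 2\<close>.\<close>
  have "(a i)\<^sup>2 \<le> (m + M) * a i - m * M" for i
  proof -
    have "0 \<le> (a i - m) * (M - a i)" using a[of i] by simp
    then show ?thesis by (simp add: power2_eq_square algebra_simps)
  qed
  then have "Q \<le> (\<Sum>i\<in>UNIV. (m + M) * a i - m * M)"
    unfolding Q_def by (intro sum_mono) auto
  also have "\<dots> = (m + M) * S - 8 * m * M"
    by (simp add: sum_subtractf S_def sum_distrib_left)
  finally have Q: "Q \<le> (m + M) * S - 8 * m * M" .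
  have mM: "m \<le> M" using a[of undefined] by linarith
  have p: "0 < m + M"
  proof (rule ccontr)
    assume "\<not> 0 < m + M"
    then have "m = 0" "M = 0" using m mM by auto
    then show False using 1 Q by simp
  qed
  have 4: "2 * M + 8 * m * M < (m + M) * S" using 1 Q by linarith
  have 5: "(1 - m - M) * S < 1 + 2 * m - 8 * m * M" using 3 Q by (simp add: algebra_simps)
  have "(1 - m - M) * (2 * M + 8 * m * M) \<le> (1 - m - M) * ((m + M) * S)"
    using 4 M mM by (intro mult_left_mono) auto
  also have "\<dots> = (m + M) * ((1 - m - M) * S)" by simp
  also have "\<dots> < (m + M) * (1 + 2 * m - 8 * m * M)"
    using 5 p by (rule mult_strict_left_mono)
  finally have "(M - m) * (1 - 2 * (M - m)) < 0" by (simp add: algebra_simps)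
  moreover have "0 \<le> (M - m) * (1 - 2 * (M - m))" using m M mM by (intro mult_nonneg_nonneg) auto
  ultimately show False by simp
qed

lemma E8_covering: "\<exists>x\<in>E8. norm (z - x) \<le> 1"
proof -
  define a where "a i = \<bar>z $ i - of_int (round (z $ i))\<bar>" for i
  have a: "0 \<le> a i" "a i \<le> 1 / 2" for i
    using of_int_round_abs_le[of "z $ i"] by (auto simp: a_def abs_minus_commute)
  \<comment> \<open>The floor of \<open>z $ i\<close> is a nearest integer to
    \<open>z $ i - 1 / 2\<close>, so the shifted coset has the complementary error.\<close>
  have b: "\<bar>(z - (1 / 2) *\<^sub>R vec 1) $ i - of_int \<lfloor>z $ i\<rfloor>\<bar> = 1 / 2 - a i" for i
    unfolding a_def round_altdef frac_def
    by (auto simp: abs_if ceiling_altdef; linarith)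
  obtain j where "a j = Max (range a)" using Max_in[of "range a"] by fastforce
  then have j: "\<And>i. a i \<le> a j" by simp
  \<comment> \<open>The smallest \<open>a k\<close> is the largest error in the shifted coset, so
    \<open>k\<close> is the coordinate to correct there.\<close>
  obtain k where "a k = Min (range a)" using Min_in[of "range a"] by fastforce
  then have k: "\<And>i. a k \<le> a i" by simp
  have "(\<Sum>i\<in>UNIV. (a i)\<^sup>2) \<le> 2 * a j \<or> (\<Sum>i\<in>UNIV. (1 / 2 - a i)\<^sup>2) \<le> 1 - 2 * a k"
    using a j k by (intro rounding_alternative) auto
  then show ?thesis
  proof
    assume 1: "(\<Sum>i\<in>UNIV. (a i)\<^sup>2) \<le> 2 * a j"
    obtain x where "x \<in> D8" "(norm (z - x))\<^sup>2 \<le> (\<Sum>i\<in>UNIV. (a i)\<^sup>2) + 1 - 2 * a j"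
      using round_D8[of z j "\<lambda>i. round (z $ i)"] a(2)[of j] by (auto simp: a_def)
    with 1 have "x \<in> E8" "(norm (z - x))\<^sup>2 \<le> 1\<^sup>2" by (auto simp: E8_def)
    then show ?thesis using power2_le_imp_le[of "norm (z - x)" 1] by (intro bexI[of _ x]) auto
  next
    assume 1: "(\<Sum>i\<in>UNIV. (1 / 2 - a i)\<^sup>2) \<le> 1 - 2 * a k"
    have sq: "((z - (1 / 2) *\<^sub>R vec 1) $ i - of_int \<lfloor>z $ i\<rfloor>)\<^sup>2 = (1 / 2 - a i)\<^sup>2" for i
      by (simp only: b[symmetric] power2_abs)
    obtain x where x: "x \<in> D8" "(norm (z - (1 / 2) *\<^sub>R vec 1 - x))\<^sup>2 \<le>
        (\<Sum>i\<in>UNIV. (1 / 2 - a i)\<^sup>2) + 1 - 2 * (1 / 2 - a k)"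
      using round_D8[of "z - (1 / 2) *\<^sub>R vec 1" k "\<lambda>i. \<lfloor>z $ i\<rfloor>"] a(1)[of k]
      unfolding b sq by auto
    define x' where "x' = (1 / 2) *\<^sub>R vec 1 + x"
    have "x' \<in> E8" using x by (auto simp: E8_def x'_def)
    moreover have "(norm (z - x'))\<^sup>2 \<le> 1\<^sup>2" using x 1 by (simp add: x'_def algebra_simps)
    ultimately show ?thesis using power2_le_imp_le[of "norm (z - x')" 1] by (intro bexI[of _ x']) auto
  qed
qed

section \<open>Symmetries and deep holes\<close>

text \<open>Phrased through distances rather than linearity, so that translations by lattice vectors
  count along with reflections.\<close>

definition E8_symmetry :: "(real ^ 8 \<Rightarrow> real ^ 8) \<Rightarrow> bool" where
  "E8_symmetry g \<longleftrightarrow> (\<forall>x y. norm (g x - g y) = norm (x - y)) \<and> bij_betw g E8 E8"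

lemma E8_symmetry_comp: "E8_symmetry g \<Longrightarrow> E8_symmetry h \<Longrightarrow> E8_symmetry (g \<circ> h)"
  unfolding E8_symmetry_def by (auto intro: bij_betw_trans)

lemma E8_symmetry_translation:
  assumes "u \<in> E8" shows "E8_symmetry (\<lambda>x. x - u)"
  unfolding E8_symmetry_def
proof
  show "bij_betw (\<lambda>x. x - u) E8 E8"
    by (rule bij_betw_byWitness[where f' = "\<lambda>x. x + u"]) (auto intro: assms E8_add E8_diff)
qed simp

text \<open>Since \<open>\<rho> \<bullet> \<rho> = 2\<close>, the map is the reflection in the
  hyperplane orthogonal to \<open>\<rho>\<close>; it preserves the lattice because inner products of
  lattice vectors are integers.\<close>

lemma E8_symmetry_root_reflection:
  assumes \<rho>: "\<rho> \<in> E8" "\<rho> \<bullet> \<rho> = 2" shows "E8_symmetry (\<lambda>x. x - (x \<bullet> \<rho>) *\<^sub>R \<rho>)"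
proof -
  define g where "g x = x - (x \<bullet> \<rho>) *\<^sub>R \<rho>" for x
  have iso: "norm (g x - g y) = norm (x - y)" for x y
  proof -
    define d where "d = x - y"
    have "(norm (d - (d \<bullet> \<rho>) *\<^sub>R \<rho>))\<^sup>2 = (norm d)\<^sup>2"
      using \<rho>(2) unfolding power2_norm_eq_inner
      by (simp add: inner_diff_left inner_diff_right inner_commute algebra_simps)
    moreover have "g x - g y = d - (d \<bullet> \<rho>) *\<^sub>R \<rho>"
      by (simp add: g_def d_def inner_diff_left algebra_simps)
    ultimately show ?thesis by (simp add: d_def)
  qed
  have inv: "g (g x) = x" for x
    using \<rho>(2) by (simp add: g_def inner_diff_left)
  have mem: "g x \<in> E8" if x: "x \<in> E8" for x
  proof -
    obtain k :: int where "x \<bullet> \<rho> = of_int k"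
      using E8_inner_Ints[OF x \<rho>(1)] by (auto elim: Ints_cases)
    then show ?thesis unfolding g_def using E8_diff[OF x E8_scale[OF \<rho>(1)]] by simp
  qed
  have "bij_betw g E8 E8"
    by (rule bij_betw_byWitness[where f' = g]) (auto simp: inv mem)
  then show ?thesis using iso unfolding E8_symmetry_def g_def by blast
qed

lemma E8_symmetry_potential:
  assumes "E8_symmetry g" shows "potential f E8 (g z) = potential f E8 z"
proof -
  have "potential f E8 (g z) = infsum (\<lambda>x. f ((norm (g x - g z))\<^sup>2)) E8"
    unfolding potential_def using assms
    by (intro infsum_reindex_bij_betw[symmetric]) (simp add: E8_symmetry_def)
  also have "\<dots> = potential f E8 z"
    using assms by (simp add: potential_def E8_symmetry_def)
  finally show ?thesis .
qed

lemma E8_symmetry_infdist: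
  assumes "E8_symmetry g" shows "infdist (g z) E8 = infdist z E8"
proof -
  have g: "g ` E8 = E8" "\<And>x. dist (g z) (g x) = dist z x"
    using assms by (auto simp: E8_symmetry_def bij_betw_def dist_norm)
  have "dist (g z) ` E8 = (\<lambda>x. dist (g z) (g x)) ` E8"
    by (subst g(1)[symmetric]) (simp add: image_image)
  then show ?thesis unfolding infdist_def g(2) by simp
qed

text \<open>Up to symmetry, \<open>axis 1 1\<close> is the only deep hole.\<close>

definition E8_holes :: "(real ^ 8) set" where
  "E8_holes = {c. \<exists>g. E8_symmetry g \<and> g c = axis 1 1}"

lemma E8_holes_symmetry: "E8_symmetry g \<Longrightarrow> g c \<in> E8_holes \<Longrightarrow> c \<in> E8_holes"
  unfolding E8_holes_def using E8_symmetry_comp by fastforce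

lemma E8_holes_axis: "s *\<^sub>R axis j 1 \<in> E8_holes" if "s = 1 \<or> s = - 1"
proof -
  have "s *\<^sub>R axis j 1 - axis 1 1 \<in> E8"
    using that E8_axis(2)[of j 1] E8_scale[OF E8_axis(1)[of j 1], of "-1"] by auto
  then show ?thesis
    unfolding E8_holes_def
    by (auto intro!: exI[of _ "\<lambda>x. x - (s *\<^sub>R axis j 1 - axis 1 1)"] E8_symmetry_translation)
qed

section \<open>Halves of lattice vectors of squared norm 4\<close>

lemma sum_int_sq_eq_1:
  fixes a :: "'n::finite \<Rightarrow> int"
  assumes "(\<Sum>i\<in>UNIV. (a i)\<^sup>2) = 1"
  shows "\<exists>j. \<bar>a j\<bar> = 1 \<and> (\<forall>i. i \<noteq> j \<longrightarrow> a i = 0)"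
proof -
  obtain j where j: "a j \<noteq> 0" using assms by (metis sum.neutral zero_neq_one zero_power2)
  have s: "(a j)\<^sup>2 + (\<Sum>i\<in>UNIV - {j}. (a i)\<^sup>2) = 1" using assms by (simp add: sum.remove[of UNIV j])
  have "(a j)\<^sup>2 \<ge> 1" using j by (simp add: int_one_le_iff_zero_less)
  moreover have "(\<Sum>i\<in>UNIV - {j}. (a i)\<^sup>2) \<ge> 0" by (intro sum_nonneg) auto
  ultimately have "(\<Sum>i\<in>UNIV - {j}. (a i)\<^sup>2) = 0" "(a j)\<^sup>2 = 1" using s by linarith+
  then have "\<forall>i\<in>UNIV - {j}. (a i)\<^sup>2 = 0" by (subst (asm) sum_nonneg_eq_0_iff) auto
  then show ?thesis using \<open>(a j)\<^sup>2 = 1\<close> by (intro exI[of _ j]) (auto simp: power2_eq_1_iff)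
qed

lemma int_unit_vector_E8_holes:
  assumes c: "\<And>i. c $ i = of_int (a i)" and n: "(norm c)\<^sup>2 = 1"
  shows "c \<in> E8_holes"
proof -
  have "of_int (\<Sum>i\<in>UNIV. (a i)\<^sup>2) = (1 :: real)" using n by (simp add: norm_sq_vec c)
  then have "(\<Sum>i\<in>UNIV. (a i)\<^sup>2) = 1" by (simp only: of_int_eq_1_iff)
  then obtain j where j: "\<bar>a j\<bar> = 1" "\<And>i. i \<noteq> j \<Longrightarrow> a i = 0"
    using sum_int_sq_eq_1 by blast
  have "c = of_int (a j) *\<^sub>R axis j 1"
    using j(2) by (auto simp: vec_eq_iff c axis_def)
  moreover have "real_of_int (a j) = 1 \<or> real_of_int (a j) = - 1" using j(1) by linarith
  ultimately show ?thesis using E8_holes_axis by metis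
qed

text \<open>Reflections are linear and hence commute with halving.\<close>

lemma half_root_reflection_E8_holes:
  assumes \<rho>: "\<rho> \<in> E8" "\<rho> \<bullet> \<rho> = 2"
    and h: "(1 / 2) *\<^sub>R (w - (w \<bullet> \<rho>) *\<^sub>R \<rho>) \<in> E8_holes"
  shows "(1 / 2) *\<^sub>R w \<in> E8_holes"
  by (rule E8_holes_symmetry[OF E8_symmetry_root_reflection[OF \<rho>]])
     (use h in \<open>simp add: algebra_simps\<close>)

text \<open>The doubled coordinates are odd with squares summing to 16, so up to sign one entry of
  \<open>w\<close> is \<open>3 / 2\<close> and the others are \<open>1 / 2\<close>. One reflection
  turns such a \<open>w\<close> into twice a signed unit vector.\<close>

lemma half_norm4_E8_holes_odd:
  assumes w: "w \<in> E8" and n: "(norm w)\<^sup>2 = 4"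
    and p: "\<And>i. w $ i = of_int p / 2 + of_int (a i)" and odd: "odd p"
  shows "(1 / 2) *\<^sub>R w \<in> E8_holes"
proof -
  define b where "b i = p + 2 * a i" for i
  have b: "w $ i = of_int (b i) / 2" "odd (b i)" for i
    using odd by (auto simp: b_def p field_simps)
  have "of_int (\<Sum>i\<in>UNIV. (b i)\<^sup>2) = (16 :: real)"
    using n by (simp add: norm_sq_vec b power_divide flip: sum_divide_distrib)
  then have b16: "(\<Sum>i\<in>UNIV. (b i)\<^sup>2) = 16"
    by (metis of_int_eq_numeral_iff)
  have ge1: "(b i)\<^sup>2 \<ge> 1" for i
    using b(2)[of i] by (cases "b i = 0") (auto simp: int_one_le_iff_zero_less)
  have "\<exists>j. (b j)\<^sup>2 \<noteq> 1"
  proof (rule ccontr)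
    assume "\<not> ?thesis"
    then have "(\<Sum>i\<in>UNIV. (b i)\<^sup>2) = 8" by simp
    then show False using b16 by simp
  qed
  then obtain j where j: "(b j)\<^sup>2 \<noteq> 1" by blast
  have "(\<Sum>i\<in>UNIV - {j}. (b i)\<^sup>2) \<ge> (\<Sum>i\<in>UNIV - {j}. 1)"
    by (intro sum_mono ge1)
  then have "(b j)\<^sup>2 \<le> 9" using b16 by (simp add: sum.remove[of UNIV j])
  then have "\<bar>b j\<bar> \<le> 3" using abs_le_square_iff[of "b j" 3] by simp
  then have bj: "b j = 3 \<or> b j = -3"
    using j b(2)[of j] by (auto simp: power2_eq_1_iff) presburger
  define s :: real where "s = sgn (w $ j)"
  have s: "s * w $ j = 3 / 2" "s * s = 1" "s = 1 \<or> s = -1"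
    using bj by (auto simp: s_def b)
  \<comment> \<open>In \<open>\<rho>\<close> the entry of size \<open>3 / 2\<close> is replaced by
    \<open>1 / 2\<close> with the opposite sign. As \<open>w \<bullet> \<rho> = 1\<close>, the
    reflection subtracts \<open>\<rho>\<close> and leaves \<open>2 * s\<close> times the axis
    vector.\<close>
  define \<rho> where "\<rho> = w - (2 * s) *\<^sub>R axis j 1"
  have "2 *\<^sub>R axis j 1 \<in> E8" using E8_axis(1)[of j j] by (simp add: scaleR_2)
  then have "(2 * s) *\<^sub>R axis j 1 \<in> E8"
    using s(3) E8_scale[of "2 *\<^sub>R axis j 1" "-1"] by auto
  then have \<rho>E: "\<rho> \<in> E8" unfolding \<rho>_def by (intro E8_diff w)
  have ww: "w \<bullet> w = 4" using n by (simp add: power2_norm_eq_inner)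
  have w\<rho>: "w \<bullet> \<rho> = 1" using s(1) by (simp add: \<rho>_def inner_diff_right ww inner_axis)
  have "\<rho> \<bullet> \<rho> = w \<bullet> \<rho> - 2 * s * (axis j 1 \<bullet> \<rho>)"
    by (simp add: \<rho>_def inner_diff_left)
  also have "axis j 1 \<bullet> \<rho> = w $ j - 2 * s"
    by (simp add: inner_axis' \<rho>_def)
  finally have "\<rho> \<bullet> \<rho> = 2" using s by (simp add: w\<rho> algebra_simps)
  moreover have "(1 / 2) *\<^sub>R (w - (w \<bullet> \<rho>) *\<^sub>R \<rho>) \<in> E8_holes"
    using E8_holes_axis[OF s(3), of j] by (simp add: w\<rho>) (simp add: \<rho>_def)
  ultimately show ?thesis using half_root_reflection_E8_holes[OF \<rho>E] by blast
qed

text \<open>Every half-integral root having odd inner product with \<open>w\<close> reflects \<open>w\<close> to a half-integral vector.\<close>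

lemma half_norm4_E8_holes:
  assumes w: "w \<in> E8" and n: "(norm w)\<^sup>2 = 4"
  shows "(1 / 2) *\<^sub>R w \<in> E8_holes"
proof -
  obtain p a where a: "\<And>i. w $ i = of_int p / 2 + of_int (a i)" and sa: "even (\<Sum>i\<in>UNIV. a i)"
    using E8_E[OF w] by blast
  show ?thesis
  proof (cases "odd p")
    case True
    then show ?thesis using half_norm4_E8_holes_odd[OF w n a] by blast
  next
    case False
    define b where "b i = p div 2 + a i" for i
    have b: "w $ i = of_int (b i)" for i
      using False by (auto simp: b_def a field_simps elim!: evenE)
    have sb: "even (\<Sum>i\<in>UNIV. b i)" using sa by (simp add: b_def sum.distrib)
    have "of_int (\<Sum>i\<in>UNIV. (b i)\<^sup>2) = (4 :: real)" using n by (simp add: norm_sq_vec b)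
    then have b4: "(\<Sum>i\<in>UNIV. (b i)\<^sup>2) = 4" by (metis of_int_eq_numeral_iff)
    show ?thesis
    proof (cases "\<forall>i. even (b i)")
      case True
      have "((1 / 2) *\<^sub>R w) $ i = of_int (b i div 2)" for i
        using True by (auto simp: b elim!: evenE dest: spec[of _ i])
      moreover have "(norm ((1 / 2) *\<^sub>R w))\<^sup>2 = 1" using n by (simp add: power_divide)
      ultimately show ?thesis by (intro int_unit_vector_E8_holes)
    next
      case False
      then obtain i where i: "odd (b i)" by blast
      have "\<exists>k. even (b k)"
      proof (rule ccontr)
        assume "\<not> ?thesis"
        then have "(b k)\<^sup>2 \<ge> 1" for k
          by (cases "b k = 0") (auto simp: int_one_le_iff_zero_less dest: spec[of _ k])
        then have "(\<Sum>k\<in>UNIV. (b k)\<^sup>2) \<ge> (\<Sum>k\<in>(UNIV :: 8 set). 1)" by (intro sum_mono)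
        then show False using b4 by simp
      qed
      then obtain k where k: "even (b k)" by blast
      have ik: "i \<noteq> k" using i k by blast
      define e :: "real ^ 8" where "e = (\<chi> i. 1 / 2)"
      \<comment> \<open>This flips the signs of the all-halves root at \<open>i\<close> and
        \<open>k\<close>. As \<open>b i\<close> is odd and \<open>b k\<close> even,
        \<open>w \<bullet> e\<close> and \<open>w \<bullet> e'\<close> have opposite parities, so
        one of the two roots has odd inner product with \<open>w\<close>.\<close>
      define e' where "e' = e - (axis i 1 + axis k 1)"
      have E: "e \<in> E8" "e' \<in> E8" unfolding e_def e'_def by (intro E8_half E8_diff E8_axis)+
      have ee: "e \<bullet> e = 2" by (simp add: e_def inner_vec_def)
      have "e' \<bullet> e' = 2"
      proof -
        have nth: "e $ l = 1 / 2" for l by (simp add: e_def)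
        have "axis i (1 :: real) $ i = 1" "axis i (1 :: real) $ k = 0"
            "axis k (1 :: real) $ i = 0" "axis k (1 :: real) $ k = 1"
          using ik by (simp_all add: axis_def)
        then show ?thesis
          using ee unfolding e'_def
          by (simp add: nth inner_diff_left inner_diff_right inner_add_left inner_add_right
                inner_axis inner_axis')
      qed
      obtain S where S: "(\<Sum>i\<in>UNIV. b i) = 2 * S" using sb by blast
      have we: "w \<bullet> e = of_int S"
      proof -
        have "w \<bullet> e = of_int (\<Sum>i\<in>UNIV. b i) / 2"
          by (simp add: inner_vec_def e_def b sum_divide_distrib)
        then show ?thesis by (simp add: S)
      qed
      have we': "w \<bullet> e' = of_int (S - b i - b k)"
        by (simp add: e'_def inner_diff_right inner_add_right we inner_axis b)
      have "\<exists>\<rho> m l. \<rho> \<in> E8 \<and> \<rho> \<bullet> \<rho> = 2 \<and> w \<bullet> \<rho> = of_int m \<and> odd m \<and>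
          (\<forall>i. \<rho> $ i = 1 / 2 + of_int (l i))"
      proof (cases "odd S")
        case True
        then show ?thesis using E ee we by (intro exI[of _ e] exI[of _ S] exI[of _ "\<lambda>_. 0"]) (auto simp: e_def)
      next
        case False
        then show ?thesis using E \<open>e' \<bullet> e' = 2\<close> we' i k
          by (intro exI[of _ e'] exI[of _ "S - b i - b k"]
                exI[of _ "\<lambda>l. - of_bool (l = i) - of_bool (l = k)"])
             (auto simp: e'_def e_def axis_def)
      qed
      then obtain \<rho> m l where \<rho>: "\<rho> \<in> E8" "\<rho> \<bullet> \<rho> = 2" "w \<bullet> \<rho> = of_int m" "odd m"
        and l: "\<And>i. \<rho> $ i = 1 / 2 + of_int (l i)" by blast
      define w' where "w' = w - (w \<bullet> \<rho>) *\<^sub>R \<rho>"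
      have "w' \<in> E8" unfolding w'_def \<rho>(3) by (intro E8_diff w E8_scale \<rho>)
      moreover have "(norm w')\<^sup>2 = 4"
        using n \<rho>(2) unfolding power2_norm_eq_inner w'_def
        by (simp add: inner_diff_left inner_diff_right inner_commute algebra_simps)
      moreover have "w' $ i = of_int (- m) / 2 + of_int (b i - m * l i)" for i
        unfolding w'_def by (simp add: b \<rho>(3) l algebra_simps)
      moreover have "odd (- m)" using \<rho>(4) by simp
      ultimately have "(1 / 2) *\<^sub>R w' \<in> E8_holes" by (rule half_norm4_E8_holes_odd)
      then show ?thesis unfolding w'_def by (rule half_root_reflection_E8_holes[OF \<rho>(1,2)])
    qed
  qed
qed

text \<open>The half-scaled lattice has covering radius \<open>1 / 2\<close>, and modulo \<open>E8\<close> its elements are \<open>0\<close>,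
  halves of roots and deep holes.\<close>

lemma E8_dichotomy:
  "(\<exists>x\<in>E8. (norm (x - z))\<^sup>2 \<le> 3 / 4) \<or> (\<exists>g. E8_symmetry g \<and> norm (g z - axis 1 1) \<le> 1 / 2)"
proof -
  \<comment> \<open>The covering radius is used twice: at twice \<open>z\<close> it puts half of a
    lattice vector within \<open>1 / 2\<close> of \<open>z\<close>; at half of \<open>w\<close> it
    reduces \<open>w\<close> modulo twice the lattice to a vector of norm at most 2.\<close>
  obtain w where w: "w \<in> E8" "norm (2 *\<^sub>R z - w) \<le> 1" using E8_covering by blast
  obtain u where u: "u \<in> E8" "norm ((1 / 2) *\<^sub>R w - u) \<le> 1" using E8_covering by blast
  define w' where "w' = w - 2 *\<^sub>R u"
  define h where "h = z - u - (1 / 2) *\<^sub>R w'"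
  have "h = (1 / 2) *\<^sub>R (2 *\<^sub>R z - w)" by (simp add: h_def w'_def algebra_simps)
  then have h: "norm h \<le> 1 / 2" using w(2) by simp
  then have h2: "h \<bullet> h \<le> 1 / 4"
    using power_mono[of "norm h" "1 / 2" 2] by (simp add: power2_norm_eq_inner power_divide)
  have w'E: "w' \<in> E8" unfolding w'_def using E8_diff[OF w(1) E8_scale[OF u(1), of 2]] by simp
  have "w' = 2 *\<^sub>R ((1 / 2) *\<^sub>R w - u)" by (simp add: w'_def algebra_simps)
  then have "norm w' \<le> 2" using u(2) by simp
  then have w'4: "(norm w')\<^sup>2 \<le> 4" using power_mono[of "norm w'" 2 2] by simp
  \<comment> \<open>Evenness leaves the squared norms 0, 2 and 4; the last gives a hole, the other
    two a close lattice point.\<close>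
  obtain k :: int where k: "(norm w')\<^sup>2 = 2 * of_int k" using E8_norm_sq_even[OF w'E] by blast
  have "0 \<le> real_of_int k" "real_of_int k \<le> 2" using k w'4 zero_le_power2[of "norm w'"] by linarith+
  then have "0 \<le> k" "k \<le> 2" by simp_all
  show ?thesis
  proof (cases "k = 2")
    case True
    then have "(1 / 2) *\<^sub>R w' \<in> E8_holes" using half_norm4_E8_holes w'E k by simp
    then obtain g where g: "E8_symmetry g" "g ((1 / 2) *\<^sub>R w') = axis 1 1"
      by (auto simp: E8_holes_def)
    have "norm (g (z - u) - axis 1 1) = norm h"
      using g by (simp add: E8_symmetry_def h_def flip: g(2))
    then show ?thesis
      using E8_symmetry_comp[OF g(1) E8_symmetry_translation[OF u(1)]] h
      by (intro disjI2 exI[of _ "g \<circ> (\<lambda>x. x - u)"]) auto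
  next
    case False
    then have "k \<le> 1" using \<open>k \<le> 2\<close> by simp
    then have k2: "w' \<bullet> w' \<le> 2" using k by (simp add: power2_norm_eq_inner)
    \<comment> \<open>\<open>z\<close> is the midpoint of \<open>u\<close> and \<open>u + w'\<close>
      displaced by \<open>h\<close>. The two cross terms have opposite signs, so one of these
      lattice points is at squared distance at most \<open>1 / 4 + 2 / 4\<close>.\<close>
    have *: "(norm (u - z))\<^sup>2 = h \<bullet> h + h \<bullet> w' + (w' \<bullet> w') / 4"
    proof -
      have "u - z = - (h + (1 / 2) *\<^sub>R w')" by (simp add: h_def)
      then show ?thesis
        by (simp only: norm_minus_cancel power2_norm_eq_inner)
          (simp add: inner_add_left inner_add_right inner_commute field_simps)
    qed
    have **: "(norm (u + w' - z))\<^sup>2 = h \<bullet> h - h \<bullet> w' + (w' \<bullet> w') / 4"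
    proof -
      have "u + w' - z = (1 / 2) *\<^sub>R w' - h" by (simp add: h_def algebra_simps flip: scaleR_2)
      then show ?thesis
        by (simp only: power2_norm_eq_inner)
          (simp add: inner_diff_left inner_diff_right inner_commute field_simps)
    qed
    show ?thesis
    proof (cases "h \<bullet> w' \<le> 0")
      case True
      then have "(norm (u - z))\<^sup>2 \<le> 3 / 4" using * h2 k2 by linarith
      then show ?thesis using u(1) by blast
    next
      case False
      then have "(norm (u + w' - z))\<^sup>2 \<le> 3 / 4" using ** h2 k2 by linarith
      then show ?thesis using E8_add[OF u(1) w'E] by blast
    qed
  qed
qed

section \<open>Gaussian sums over the lattice\<close>

lemma sum_geometric_abs:
  fixes q :: real
  assumes "0 \<le> q" "q < 1"
  shows "(\<Sum>k\<in>{- int N..int N}. q ^ nat \<bar>k\<bar>) \<le> 1 + 2 * q / (1 - q)"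
proof -
  have "(\<Sum>k\<in>{- int N..int N}. q ^ nat \<bar>k\<bar>) = 1 + 2 * (q - q ^ Suc N) / (1 - q)"
  proof (induction N)
    case (Suc N)
    have "{- int (Suc N)..int (Suc N)} = insert (- int (Suc N)) (insert (int (Suc N)) {- int N..int N})"
      by auto
    then have "(\<Sum>k\<in>{- int (Suc N)..int (Suc N)}. q ^ nat \<bar>k\<bar>) =
        2 * q ^ Suc N + (\<Sum>k\<in>{- int N..int N}. q ^ nat \<bar>k\<bar>)"
      by (simp add: nat_add_distrib)
    then show ?case unfolding Suc.IH using assms by (simp add: field_simps)
  qed simp
  also have "\<dots> \<le> 1 + 2 * q / (1 - q)"
    using assms by (intro add_left_mono divide_right_mono) auto
  finally show ?thesis .
qed

definition half_integer_grid :: "(real ^ 'n) set" where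
  "half_integer_grid = {x. \<forall>i. 2 * x $ i \<in> \<int>}"

text \<open>Over a box of grid points the Gaussian sum factors into coordinates, and
  \<open>k\<^sup>2 \<ge> \<bar>k\<bar>\<close> compares each factor with a geometric series; the
  quarter in \<open>q\<close> comes from writing coordinates as \<open>k / 2\<close>. The bound is
  uniform in \<open>F\<close> and serves both summability and the numerical tail estimate.\<close>

lemma sum_gaussian_grid_le:
  fixes F :: "(real ^ 'n) set"
  assumes \<beta>: "\<beta> > 0" and F: "finite F" "F \<subseteq> half_integer_grid"
  defines "q \<equiv> exp (- \<beta> / 4)"
  shows "(\<Sum>x\<in>F. exp (- \<beta> * (norm x)\<^sup>2)) \<le> (1 + 2 * q / (1 - q)) ^ CARD('n)"
proof -
  have q: "0 \<le> q" "q < 1" using \<beta> by (auto simp: q_def)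
  have "finite ((\<lambda>(x, i). nat \<bar>\<lfloor>2 * x $ i\<rfloor>\<bar>) ` (F \<times> UNIV))" using F(1) by simp
  then obtain N where "\<forall>n\<in>(\<lambda>(x, i). nat \<bar>\<lfloor>2 * x $ i\<rfloor>\<bar>) ` (F \<times> UNIV). n \<le> N"
    unfolding finite_nat_set_iff_bounded_le by blast
  then have N: "nat \<bar>\<lfloor>2 * x $ i\<rfloor>\<bar> \<le> N" if "x \<in> F" for x i using that by simp
  define P where "P = (PiE UNIV (\<lambda>_. {- int N..int N}) :: ('n \<Rightarrow> int) set)"
  define h where "h k = (\<chi> i. real_of_int (k i) / 2)" for k :: "'n \<Rightarrow> int"
  have finP: "finite P" unfolding P_def by (intro finite_PiE) auto
  have sub: "F \<subseteq> h ` P"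
  proof
    fix x assume x: "x \<in> F"
    have "x $ i = of_int \<lfloor>2 * x $ i\<rfloor> / 2" for i
    proof -
      have "2 * x $ i \<in> \<int>" using F(2) x by (auto simp: half_integer_grid_def)
      then obtain k where k: "2 * x $ i = of_int k" by (auto elim: Ints_cases)
      then have "\<lfloor>2 * x $ i\<rfloor> = k" by simp
      then show ?thesis using k by simp
    qed
    then have "x = h (\<lambda>i. \<lfloor>2 * x $ i\<rfloor>)" by (simp add: vec_eq_iff h_def)
    moreover have "(\<lambda>i. \<lfloor>2 * x $ i\<rfloor>) \<in> P" unfolding P_def
      using N[OF x] by (auto simp: PiE_def Pi_def nat_le_iff abs_le_iff minus_le_iff)
    ultimately show "x \<in> h ` P" by blast
  qed
  have "(\<Sum>x\<in>F. exp (- \<beta> * (norm x)\<^sup>2)) \<le> (\<Sum>x\<in>h ` P. exp (- \<beta> * (norm x)\<^sup>2))"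
    using finP sub by (intro sum_mono2) auto
  also have "\<dots> \<le> (\<Sum>k\<in>P. exp (- \<beta> * (norm (h k))\<^sup>2))"
    using sum_image_le[OF finP, of "\<lambda>x. exp (- \<beta> * (norm x)\<^sup>2)" h] by (simp add: comp_def)
  also have "\<dots> = (\<Sum>k\<in>P. \<Prod>i\<in>UNIV. exp (- \<beta> / 4 * (of_int (k i))\<^sup>2))"
    by (simp add: norm_sq_vec h_def power_divide sum_distrib_left flip: exp_sum)
  also have "\<dots> = (\<Prod>i\<in>(UNIV :: 'n set). \<Sum>k\<in>{- int N..int N}. exp (- \<beta> / 4 * (of_int k)\<^sup>2))"
    unfolding P_def by (subst prod_sum_PiE) auto
  also have "\<dots> = (\<Sum>k\<in>{- int N..int N}. exp (- \<beta> / 4 * (of_int k)\<^sup>2)) ^ CARD('n)"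
    by simp
  also have "\<dots> \<le> (1 + 2 * q / (1 - q)) ^ CARD('n)"
  proof (rule power_mono)
    have "exp (- \<beta> / 4 * (of_int k)\<^sup>2) \<le> q ^ nat \<bar>k\<bar>" for k :: int
    proof -
      have "\<bar>k\<bar> \<le> k\<^sup>2"
        using self_le_power[of "\<bar>k\<bar>" 2] by (cases "k = 0") auto
      then have "real_of_int \<bar>k\<bar> \<le> real_of_int (k\<^sup>2)" by (simp only: of_int_le_iff)
      then have *: "real (nat \<bar>k\<bar>) \<le> (of_int k)\<^sup>2" by simp
      have "exp (- \<beta> / 4 * (of_int k)\<^sup>2) \<le> exp (- \<beta> / 4 * real (nat \<bar>k\<bar>))"
        using \<beta> * by (simp only: exp_le_cancel_iff) (intro mult_left_mono_neg, auto)
      also have "\<dots> = q ^ nat \<bar>k\<bar>" unfolding q_def by (simp add: exp_of_nat_mult[symmetric] mult.commute)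
      finally show ?thesis .
    qed
    then have "(\<Sum>k\<in>{- int N..int N}. exp (- \<beta> / 4 * (of_int k)\<^sup>2)) \<le> (\<Sum>k\<in>{- int N..int N}. q ^ nat \<bar>k\<bar>)"
      by (intro sum_mono)
    also have "\<dots> \<le> 1 + 2 * q / (1 - q)" using q by (rule sum_geometric_abs)
    finally show "(\<Sum>k\<in>{- int N..int N}. exp (- \<beta> / 4 * (of_int k)\<^sup>2)) \<le> 1 + 2 * q / (1 - q)" .
  qed (auto intro: sum_nonneg)
  finally show ?thesis .
qed

lemma E8_subset_grid: "E8 \<subseteq> half_integer_grid"
  by (auto simp: half_integer_grid_def E8_half_integral)

text \<open>The inequality \<open>(norm x)\<^sup>2 \<le> 2 * (norm (x - z))\<^sup>2 + 2 * (norm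
  z)\<^sup>2\<close> moves the centre to 0 at the cost of a constant factor and half the
  exponent.\<close>

lemma summable_gaussian_E8:
  assumes \<alpha>: "\<alpha> > 0" shows "(\<lambda>x. exp (- \<alpha> * (norm (x - z))\<^sup>2)) summable_on E8"
proof (rule summable_on_comparison_test)
  have "(\<lambda>x :: real ^ 8. exp (- (\<alpha> / 2) * (norm x)\<^sup>2)) summable_on E8"
  proof (rule nonneg_bdd_above_summable_on)
    show "bdd_above (sum (\<lambda>x :: real ^ 8. exp (- (\<alpha> / 2) * (norm x)\<^sup>2)) ` {F. F \<subseteq> E8 \<and> finite F})"
      using sum_gaussian_grid_le[of "\<alpha> / 2"] \<alpha> E8_subset_grid
      by (intro bdd_aboveI2) (fastforce intro: order_trans)
  qed auto
  then show "(\<lambda>x. exp (\<alpha> * (norm z)\<^sup>2) * exp (- (\<alpha> / 2) * (norm x)\<^sup>2)) summable_on E8"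
    by (rule summable_on_cmult_right)
  show "exp (- \<alpha> * (norm (x - z))\<^sup>2) \<le> exp (\<alpha> * (norm z)\<^sup>2) * exp (- (\<alpha> / 2) * (norm x)\<^sup>2)" for x
  proof -
    have "norm x \<le> norm (x - z) + norm z" using norm_triangle_ineq[of "x - z" z] by simp
    then have "(norm x)\<^sup>2 \<le> (norm (x - z) + norm z)\<^sup>2" by (intro power_mono) auto
    also have "\<dots> \<le> 2 * (norm (x - z))\<^sup>2 + 2 * (norm z)\<^sup>2"
      using zero_le_power2[of "norm (x - z) - norm z"] by (simp add: power2_eq_square algebra_simps)
    finally have "\<alpha> / 2 * (norm x)\<^sup>2 \<le> \<alpha> / 2 * (2 * (norm (x - z))\<^sup>2 + 2 * (norm z)\<^sup>2)"
      using \<alpha> by (intro mult_left_mono) auto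
    then show ?thesis by (simp add: algebra_simps flip: exp_add)
  qed
qed auto

section \<open>Hyperbolic cosine inequalities\<close>

text \<open>Monotonicity of \<open>sinh t / t\<close>, cross-multiplied to include 0:
  \<open>sinh\<close> is convex on the nonnegative axis and vanishes at 0.\<close>

lemma sinh_ratio_mono:
  fixes s t :: real
  assumes "0 \<le> s" "s \<le> t" shows "t * sinh s \<le> s * sinh t"
proof (cases "t = 0")
  case False
  then have t: "t > 0" using assms by simp
  have conv: "convex_on {0..} (sinh :: real \<Rightarrow> real)"
    by (rule f''_ge0_imp_convex[where f' = cosh and f'' = sinh]) (auto intro!: derivative_eq_intros)
  have "sinh ((1 - s / t) *\<^sub>R 0 + (s / t) *\<^sub>R t) \<le> (1 - s / t) * sinh 0 + s / t * sinh t"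
    using assms t by (intro convex_onD[OF conv]) auto
  then show ?thesis using t by (simp add: field_simps)
qed (use assms in auto)

text \<open>The tangent inequality expressing convexity of \<open>t \<mapsto> cosh (sqrt t)\<close>.\<close>

lemma cosh_ge_tangent:
  fixes t v :: real
  assumes v: "v > 0" shows "cosh v + (t\<^sup>2 - v\<^sup>2) * (sinh v / (2 * v)) \<le> cosh t"
proof -
  define c where "c = sinh v / (2 * v)"
  \<comment> \<open>Up to a constant this is \<open>cosh s\<close> minus its tangent at
    \<open>v\<close> in the variable \<open>s\<^sup>2\<close>. By \<open>sinh_ratio_mono\<close> its
    derivative is nonpositive on \<open>[0, v]\<close> and nonnegative beyond, so \<open>v\<close>
    is a minimum.\<close>
  define \<phi> where "\<phi> s = cosh s - s\<^sup>2 * c" for s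
  have D: "(\<phi> has_real_derivative (sinh s - 2 * s * c)) (at s)" for s
    unfolding \<phi>_def by (auto intro!: derivative_eq_intros)
  have c: "v * (2 * s * c) = s * sinh v" for s using v by (simp add: c_def)
  have le: "\<phi> v \<le> \<phi> s" if s: "s \<ge> 0" for s
  proof (cases "s \<le> v")
    case True
    have "sinh r - 2 * r * c \<le> 0" if "s \<le> r" "r \<le> v" for r
    proof -
      have "v * sinh r \<le> v * (2 * r * c)" unfolding c using sinh_ratio_mono[of r v] s that by simp
      then show ?thesis using v by simp
    qed
    then show ?thesis using DERIV_nonpos_imp_nonincreasing[OF True] D by meson
  next
    case False
    then have vs: "v \<le> s" by simp
    have "sinh r - 2 * r * c \<ge> 0" if "v \<le> r" for r
    proof -
      have "v * (2 * r * c) \<le> v * sinh r" unfolding c using sinh_ratio_mono[of v r] v that by simp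
      then show ?thesis using v by simp
    qed
    then show ?thesis using DERIV_nonneg_imp_nondecreasing[OF vs] D by meson
  qed
  have "\<phi> v \<le> \<phi> \<bar>t\<bar>" by (rule le) simp
  then show ?thesis unfolding c_def[symmetric] by (simp add: \<phi>_def left_diff_distrib)
qed

lemma cosh_ge_quadratic: "1 + t\<^sup>2 / 2 \<le> cosh (t :: real)"
proof -
  have sinh: "s \<le> sinh s" if "s \<ge> 0" for s :: real
  proof -
    have "sinh 0 - 0 \<le> sinh s - s"
    proof (rule DERIV_nonneg_imp_nondecreasing[where f = "\<lambda>s. sinh s - s", OF that])
      fix x :: real
      show "\<exists>y. ((\<lambda>s. sinh s - s) has_real_derivative y) (at x) \<and> 0 \<le> y"
        by (rule exI[of _ "cosh x - 1"]) (auto intro!: derivative_eq_intros cosh_real_ge_1)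
    qed
    then show ?thesis by simp
  qed
  have "cosh 0 - 0\<^sup>2 / 2 \<le> cosh \<bar>t\<bar> - \<bar>t\<bar>\<^sup>2 / 2"
  proof (rule DERIV_nonneg_imp_nondecreasing[where f = "\<lambda>s. cosh s - s\<^sup>2 / 2"])
    fix x :: real assume "0 \<le> x"
    then show "\<exists>y. ((\<lambda>s. cosh s - s\<^sup>2 / 2) has_real_derivative y) (at x) \<and> 0 \<le> y"
      by (intro exI[of _ "sinh x - x"]) (auto intro!: derivative_eq_intros sinh)
  qed simp
  then show ?thesis by simp
qed

text \<open>Jensen's inequality: \<open>v\<^sup>2\<close> is the mean of the squares of the
  \<open>\<beta> * y $ i\<close>, so the linear terms cancel when \<open>cosh_ge_tangent\<close> is
  summed.\<close>

lemma sum_cosh_ge: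
  fixes y :: "real ^ 'n"
  shows "real CARD('n) * cosh (\<beta> * norm y / sqrt CARD('n)) \<le> (\<Sum>i\<in>UNIV. cosh (\<beta> * y $ i))"
proof (cases "\<beta> * norm y = 0")
  case True
  then show ?thesis by auto
next
  case False
  define v where "v = \<bar>\<beta>\<bar> * norm y / sqrt CARD('n)"
  have v: "v > 0" using False by (simp add: v_def)
  have cv: "cosh (\<beta> * norm y / sqrt CARD('n)) = cosh v"
    by (subst cosh_real_abs[symmetric]) (simp add: v_def abs_mult)
  have vsq: "real CARD('n) * v\<^sup>2 = \<beta>\<^sup>2 * (norm y)\<^sup>2"
    by (simp add: v_def power_mult_distrib power_divide)
  have "(\<Sum>i\<in>UNIV. cosh v + ((\<beta> * y $ i)\<^sup>2 - v\<^sup>2) * (sinh v / (2 * v))) \<le> (\<Sum>i\<in>UNIV. cosh (\<beta> * y $ i))"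
    by (intro sum_mono cosh_ge_tangent v)
  moreover have "(\<Sum>i\<in>UNIV. cosh v + ((\<beta> * y $ i)\<^sup>2 - v\<^sup>2) * (sinh v / (2 * v))) =
      real CARD('n) * cosh v + (\<Sum>i\<in>UNIV. (\<beta> * y $ i)\<^sup>2 - v\<^sup>2) * (sinh v / (2 * v))"
    unfolding sum.distrib sum_distrib_right[symmetric] by simp
  moreover have "(\<Sum>i\<in>UNIV. (\<beta> * y $ i)\<^sup>2 - v\<^sup>2) = \<beta>\<^sup>2 * (norm y)\<^sup>2 - real CARD('n) * v\<^sup>2"
    by (simp add: sum_subtractf norm_sq_vec sum_distrib_left power_mult_distrib)
  ultimately show ?thesis unfolding vsq cv by simp
qed

text \<open>The factor 10 is half of \<open>20 = 16 + 4\<close>, the coefficient of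
  \<open>exp (- \<alpha>)\<close> in the bound for the potential of a hole. Small
  \<open>\<alpha> * (norm y)\<^sup>2\<close> is handled by the quadratic bound on
  \<open>cosh\<close>, large values by Jensen.\<close>

lemma sum_cosh_gt:
  fixes y :: "real ^ 8"
  assumes \<alpha>: "\<alpha> \<ge> 23" and y: "y \<noteq> 0" "norm y \<le> 1 / 2"
  shows "10 * (exp (\<alpha> * (norm y)\<^sup>2) - 1) < (\<Sum>i\<in>UNIV. cosh (2 * \<alpha> * y $ i)) - 8"
proof -
  define r where "r = norm y"
  define x where "x = \<alpha> * r\<^sup>2"
  have r: "0 < r" "r \<le> 1 / 2" using y by (auto simp: r_def)
  have x: "0 < x" using r \<alpha> by (simp add: x_def)
  show ?thesis
  proof (cases "x \<le> 2")
    case True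
    \<comment> \<open>The chord of \<open>exp\<close> over \<open>[0, 2]\<close> has slope at most
      4; the resulting \<open>10 * 4\<close> stays below the slope \<open>2 * 23\<close> from the
      quadratic bound.\<close>
    have conv: "convex_on UNIV (exp :: real \<Rightarrow> real)" by (rule exp_convex)
    have "exp ((1 - x / 2) *\<^sub>R 0 + (x / 2) *\<^sub>R 2) \<le> (1 - x / 2) * exp 0 + x / 2 * exp (2 :: real)"
      using x True by (intro convex_onD[OF conv]) auto
    moreover have "exp (2 :: real) \<le> 9"
      using exp_le power_mono[of "exp 1" "3 :: real" 2] by (simp flip: exp_of_nat_mult)
    then have "x / 2 * exp 2 \<le> x / 2 * 9" using x by (intro mult_left_mono) auto
    ultimately have e: "exp x - 1 \<le> 4 * x" by simp
    have "(\<Sum>i\<in>UNIV. 1 + (2 * \<alpha> * y $ i)\<^sup>2 / 2) \<le> (\<Sum>i\<in>UNIV. cosh (2 * \<alpha> * y $ i))"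
      by (intro sum_mono cosh_ge_quadratic)
    moreover have "(\<Sum>i\<in>UNIV. 1 + (2 * \<alpha> * y $ i)\<^sup>2 / 2) = 8 + 2 * \<alpha> * x"
      by (simp add: sum.distrib x_def r_def norm_sq_vec power_mult_distrib flip: sum_distrib_left)
        (simp add: power2_eq_square)
    moreover have "23 * x \<le> \<alpha> * x" using \<alpha> x by (intro mult_right_mono) auto
    ultimately show ?thesis using e x by (simp add: x_def r_def)
  next
    case False
    define v where "v = 2 * \<alpha> * r / sqrt 8"
    have v0: "v > 0" using \<alpha> r by (simp add: v_def)
    have v2: "v\<^sup>2 = \<alpha> * x / 2"
      by (simp add: v_def x_def power_mult_distrib power_divide) (simp add: power2_eq_square)
    have "23 * 2 \<le> \<alpha> * x" using \<alpha> False by (intro mult_mono) auto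
    then have "(47 / 10)\<^sup>2 \<le> v\<^sup>2" unfolding v2 by (simp add: power2_eq_square)
    then have v: "47 / 10 \<le> v" by (rule power2_le_imp_le) (use v0 in simp)
    \<comment> \<open>This gives \<open>x\<^sup>2 \<le> v\<^sup>2 / 2\<close>, and
      \<open>71 / 100\<close> lies just above the square root of \<open>1 / 2\<close>. The remaining
      \<open>29 / 100 * v\<close> must supply the factor \<open>10 / 4\<close>, which
      \<open>v \<ge> 47 / 10\<close> ensures.\<close>
    have "r\<^sup>2 \<le> 1 / 4" using power_mono[OF r(2), of 2] r by (simp add: power_divide)
    then have "\<alpha> * x * r\<^sup>2 \<le> \<alpha> * x * (1 / 4)" using \<alpha> x by (intro mult_left_mono) auto
    moreover have "x\<^sup>2 = \<alpha> * x * r\<^sup>2" by (simp add: x_def power2_eq_square)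
    ultimately have "x\<^sup>2 \<le> (71 / 100 * v)\<^sup>2"
      using \<alpha> x by (simp add: power_mult_distrib v2 power_divide) 
    then have xv: "x \<le> 71 / 100 * v" by (rule power2_le_imp_le) (use v0 in simp)
    have "5 / 2 \<le> 1 + 29 / 100 * v + (29 / 100 * v)\<^sup>2 / 2"
      using v power_mono[of "47 / 10 * (29 / 100)" "29 / 100 * v" 2] by (simp add: power2_eq_square)
    also have "\<dots> \<le> exp (29 / 100 * v)" using v0 by (intro exp_lower_Taylor_quadratic) auto
    finally have "exp (71 / 100 * v) * (5 / 2) \<le> exp (71 / 100 * v) * exp (29 / 100 * v)" by simp
    also have "\<dots> = exp v" by (simp flip: exp_add)
    finally have "10 * exp (71 / 100 * v) \<le> 4 * exp v" by simp
    moreover have "exp x \<le> exp (71 / 100 * v)" using xv by simp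
    moreover have "exp v < 2 * cosh v" by (simp add: cosh_def)
    ultimately have "10 * (exp x - 1) < 8 * cosh v - 8" by argo
    also have "8 * cosh v \<le> (\<Sum>i\<in>UNIV. cosh (2 * \<alpha> * y $ i))"
      using sum_cosh_ge[of "2 * \<alpha>" y] by (simp add: v_def r_def)
    finally show ?thesis by (simp add: x_def r_def)
  qed
qed

section \<open>Potential and distance near and far from a deep hole\<close>

text \<open>The sixteen lattice points nearest to \<open>axis 1 1\<close>, all at distance 1 from
  it.\<close>

definition cross_polytope :: "(real ^ 8) set" where
  "cross_polytope = range (\<lambda>i. axis 1 1 + axis i 1) \<union> range (\<lambda>i. axis 1 1 - axis i 1)"

lemma cross_polytope_subset: "cross_polytope \<subseteq> E8"
  using E8_axis by (auto simp: cross_polytope_def)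

lemma finite_cross_polytope: "finite cross_polytope"
  by (simp add: cross_polytope_def)

lemma sum_cross_polytope:
  "(\<Sum>x\<in>cross_polytope. f x) = (\<Sum>i\<in>UNIV. f (axis 1 1 + axis i 1) + f (axis 1 1 - axis i 1))"
proof -
  have inj: "inj (\<lambda>i. axis 1 1 + axis i 1 :: real ^ 8)" "inj (\<lambda>i. axis 1 1 - axis i 1 :: real ^ 8)"
    by (auto simp: inj_def axis_eq_axis)
  have ne: "axis i 1 \<noteq> - axis j (1 :: real)" for i j :: 8
  proof
    assume "axis i 1 = - axis j (1 :: real)"
    then have "axis i (1 :: real) $ i = (- axis j 1) $ i" by simp
    then show False by (auto simp: axis_def split: if_splits)
  qed
  have "range (\<lambda>i. axis 1 1 + axis i 1 :: real ^ 8) \<inter> range (\<lambda>i. axis 1 1 - axis i 1) = {}"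
  proof -
    have "axis 1 1 + axis i 1 \<noteq> (axis 1 1 - axis j 1 :: real ^ 8)" for i j
      using ne[of i j] by (metis add_left_cancel diff_conv_add_uminus)
    then show ?thesis by auto
  qed
  then show ?thesis
    unfolding cross_polytope_def using inj
    by (simp add: sum.union_disjoint sum.reindex comp_def sum.distrib)
qed

text \<open>For half-integral \<open>x\<close> all eight entries of the difference have size at
  least \<open>1 / 2\<close>. For integral \<open>x\<close> the difference has odd coordinate sum,
  hence odd squared norm, and the value 1 occurs only in the cross polytope.\<close>

lemma norm_sq_ge_off_cross_polytope:
  assumes x: "x \<in> E8" "x \<notin> cross_polytope"
  shows "2 \<le> (norm (x - axis 1 1))\<^sup>2"
proof -
  obtain p a where a: "\<And>i. x $ i = of_int p / 2 + of_int (a i)" and sa: "even (\<Sum>i\<in>UNIV. a i)"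
    using E8_E[OF x(1)] by blast
  show ?thesis
  proof (cases "even p")
    case False
    have "1 / 4 \<le> ((x - axis 1 1) $ i)\<^sup>2" for i
    proof -
      define b where "b = p + 2 * a i - 2 * of_bool (i = 1)"
      have b: "(x - axis 1 1) $ i = of_int b / 2" by (simp add: b_def a axis_def)
      have "odd b" using False by (simp add: b_def)
      then have "b \<noteq> 0" by auto
      then have "b\<^sup>2 \<ge> 1" by (simp add: int_one_le_iff_zero_less)
      then have "(of_int b)\<^sup>2 \<ge> (1 :: real)" by (metis of_int_1_le_iff of_int_power)
      then show ?thesis unfolding b power_divide by simp
    qed
    then have "(\<Sum>i\<in>(UNIV :: 8 set). 1 / 4) \<le> (norm (x - axis 1 1))\<^sup>2"
      unfolding norm_sq_vec by (intro sum_mono)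
    then show ?thesis by simp
  next
    case True
    then obtain q where q: "p = 2 * q" by blast
    define b where "b i = q + a i - of_bool (i = 1)" for i
    have b: "(x - axis 1 1) $ i = of_int (b i)" for i by (simp add: b_def a q axis_def)
    have sb: "odd (\<Sum>i\<in>UNIV. b i)" using sa by (simp add: b_def sum.distrib sum_subtractf)
    have "even (\<Sum>i\<in>UNIV. (b i)\<^sup>2 - b i)" by (intro dvd_sum) simp
    then have odd: "odd (\<Sum>i\<in>UNIV. (b i)\<^sup>2)" using sb by (simp add: sum_subtractf)
    have n: "(norm (x - axis 1 1))\<^sup>2 = of_int (\<Sum>i\<in>UNIV. (b i)\<^sup>2)" unfolding norm_sq_vec b by simp
    have "(\<Sum>i\<in>UNIV. (b i)\<^sup>2) \<noteq> 1"
    proof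
      assume "(\<Sum>i\<in>UNIV. (b i)\<^sup>2) = 1"
      then obtain j where j: "\<bar>b j\<bar> = 1" "\<And>i. i \<noteq> j \<Longrightarrow> b i = 0" using sum_int_sq_eq_1 by blast
      have "x - axis 1 1 = of_int (b j) *\<^sub>R axis j 1"
        using j(2) unfolding vec_eq_iff b by (auto simp: axis_def)
      moreover have "b j = 1 \<or> b j = -1" using j(1) by linarith
      ultimately have "x = axis 1 1 + axis j 1 \<or> x = axis 1 1 - axis j 1"
        by (auto simp: algebra_simps)
      then show False using x(2) by (auto simp: cross_polytope_def)
    qed
    moreover have "(\<Sum>i\<in>UNIV. (b i)\<^sup>2) \<ge> 0" by (intro sum_nonneg) auto
    ultimately have "(\<Sum>i\<in>UNIV. (b i)\<^sup>2) \<ge> 2" using odd by presburger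
    then have "real_of_int 2 \<le> of_int (\<Sum>i\<in>UNIV. (b i)\<^sup>2)" by (simp only: of_int_le_iff)
    then show ?thesis unfolding n by simp
  qed
qed

section \<open>Contributions of the nearest points and of the remaining lattice\<close>

lemma potential_gaussian:
  "potential (gaussian \<alpha>) E8 z = infsum (\<lambda>x. exp (- \<alpha> * (norm (x - z))\<^sup>2)) E8"
  by (simp add: potential_def gaussian_def)

lemma potential_split:
  assumes "\<alpha> > 0"
  shows "potential (gaussian \<alpha>) E8 z =
    (\<Sum>i\<in>UNIV. exp (- \<alpha> * (norm (axis 1 1 + axis i 1 - z))\<^sup>2) + exp (- \<alpha> * (norm (axis 1 1 - axis i 1 - z))\<^sup>2)) +
    infsum (\<lambda>x. exp (- \<alpha> * (norm (x - z))\<^sup>2)) (E8 - cross_polytope)"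
proof -
  define F where "F = (\<lambda>x. exp (- \<alpha> * (norm (x - z))\<^sup>2))"
  have "infsum F (cross_polytope \<union> (E8 - cross_polytope)) =
      infsum F cross_polytope + infsum F (E8 - cross_polytope)"
    using summable_gaussian_E8[OF assms, of z] finite_cross_polytope unfolding F_def[symmetric]
    by (intro infsum_Un_disjoint) (auto intro: summable_on_subset_banach)
  moreover have "cross_polytope \<union> (E8 - cross_polytope) = E8" using cross_polytope_subset by auto
  ultimately show ?thesis
    using finite_cross_polytope by (simp add: potential_gaussian sum_cross_polytope F_def)
qed

text \<open>A squared distance \<open>n \<ge> 2\<close> satisfies
  \<open>\<alpha> * n \<ge> \<alpha> + 23 / 2 * n\<close>. So a factor
  \<open>exp (- \<alpha>)\<close> splits off, leaving a fixed Gaussian sum over the half-integer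
  grid.\<close>

lemma tail_bound:
  assumes \<alpha>: "\<alpha> \<ge> 23"
  shows "infsum (\<lambda>x. exp (- \<alpha> * (norm (x - axis 1 1))\<^sup>2)) (E8 - cross_polytope) \<le> 4 * exp (- \<alpha>)"
proof (rule infsum_le_finite_sums)
  show "(\<lambda>x. exp (- \<alpha> * (norm (x - axis 1 1))\<^sup>2)) summable_on (E8 - cross_polytope)"
    using summable_gaussian_E8[of \<alpha> "axis 1 1"] \<alpha> by (auto intro: summable_on_subset_banach)
  fix F assume F: "finite F" "F \<subseteq> E8 - cross_polytope"
  define q :: real where "q = exp (- (23 / 2) / 4)"
  define F' where "F' = (\<lambda>x. x - axis 1 1) ` F"
  have F': "finite F'" "F' \<subseteq> half_integer_grid"
  proof -
    have "x - axis 1 1 \<in> half_integer_grid" if "x \<in> E8" for x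
      using E8_half_integral[OF that] by (auto simp: half_integer_grid_def axis_def algebra_simps)
    then show "F' \<subseteq> half_integer_grid" using F by (auto simp: F'_def)
  qed (use F in \<open>simp add: F'_def\<close>)
  have "(\<Sum>x\<in>F. exp (- \<alpha> * (norm (x - axis 1 1))\<^sup>2)) \<le>
      (\<Sum>x\<in>F. exp (- \<alpha>) * exp (- (23 / 2) * (norm (x - axis 1 1))\<^sup>2))"
  proof (rule sum_mono)
    fix x assume "x \<in> F"
    then have 2: "2 \<le> (norm (x - axis 1 1))\<^sup>2" using F norm_sq_ge_off_cross_polytope by blast
    have "23 * ((norm (x - axis 1 1))\<^sup>2 - 1) \<le> \<alpha> * ((norm (x - axis 1 1))\<^sup>2 - 1)"
      using \<alpha> 2 by (intro mult_right_mono) auto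
    then have "- \<alpha> * (norm (x - axis 1 1))\<^sup>2 \<le> - \<alpha> + - (23 / 2) * (norm (x - axis 1 1))\<^sup>2"
      using 2 by (simp add: algebra_simps)
    then show "exp (- \<alpha> * (norm (x - axis 1 1))\<^sup>2) \<le> exp (- \<alpha>) * exp (- (23 / 2) * (norm (x - axis 1 1))\<^sup>2)"
      unfolding exp_add[symmetric] by simp
  qed
  also have "\<dots> = exp (- \<alpha>) * (\<Sum>u\<in>F'. exp (- (23 / 2) * (norm u)\<^sup>2))"
    unfolding F'_def by (subst sum.reindex) (auto simp: inj_on_def sum_distrib_left)
  also have "(\<Sum>u\<in>F'. exp (- (23 / 2) * (norm u)\<^sup>2)) \<le> (1 + 2 * q / (1 - q)) ^ 8"
    using sum_gaussian_grid_le[of "23 / 2" F'] F' by (simp add: q_def)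
  also have "(1 + 2 * q / (1 - q)) ^ 8 \<le> (13 / 11) ^ 8"
  proof (rule power_mono)
    \<comment> \<open>The quadratic Taylor bound at \<open>23 / 8\<close> falls short of 12, so it
      is applied at half the exponent and squared.\<close>
    have "12 \<le> (1 + 23 / 16 + (23 / 16)\<^sup>2 / 2 :: real) ^ 2" by (simp add: power2_eq_square)
    also have "\<dots> \<le> exp (23 / 16) ^ 2" by (intro power_mono exp_lower_Taylor_quadratic) auto
    also have "\<dots> = exp (23 / 8)" by (simp flip: exp_of_nat_mult)
    finally have "q \<le> 1 / 12" by (simp add: q_def exp_minus field_simps)
    then show "1 + 2 * q / (1 - q) \<le> 13 / 11" by (simp add: field_simps)
    show "0 \<le> 1 + 2 * q / (1 - q)" using \<open>q \<le> 1 / 12\<close> by (simp add: q_def)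
  qed
  also have "(13 / 11) ^ 8 \<le> (4 :: real)" by (simp add: eval_nat_numeral)
  finally show "(\<Sum>x\<in>F. exp (- \<alpha> * (norm (x - axis 1 1))\<^sup>2)) \<le> 4 * exp (- \<alpha>)"
    by (simp add: mult.commute)
qed

text \<open>Averaging over the point reflection in \<open>axis 1 1\<close> and \<open>cosh \<ge> 1\<close>.\<close>

lemma tail_lower:
  assumes \<alpha>: "\<alpha> > 0"
  shows "exp (- \<alpha> * (norm y)\<^sup>2) * infsum (\<lambda>x. exp (- \<alpha> * (norm (x - axis 1 1))\<^sup>2)) (E8 - cross_polytope)
    \<le> infsum (\<lambda>x. exp (- \<alpha> * (norm (x - (axis 1 1 + y)))\<^sup>2)) (E8 - cross_polytope)"
proof -
  define A where "A = E8 - cross_polytope"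
  define F where "F = (\<lambda>z x :: real ^ 8. exp (- \<alpha> * (norm (x - z))\<^sup>2))"
  define c :: "real ^ 8" where "c = axis 1 1"
  define r where "r x = 2 *\<^sub>R c - x" for x
  define K where "K = exp (- \<alpha> * (norm y)\<^sup>2)"
  \<comment> \<open>Twice \<open>c\<close> is a lattice vector, and the reflection swaps opposite
    vertices of the cross polytope, so it permutes the tail.\<close>
  have r: "r x \<in> A" if "x \<in> A" for x
  proof -
    have "2 *\<^sub>R c \<in> E8" using E8_axis(1)[of 1 1] by (simp add: c_def scaleR_2)
    then have "r x \<in> E8" using that by (simp add: r_def A_def E8_diff)
    moreover have "x \<in> cross_polytope" if "r x \<in> cross_polytope"
    proof -
      have "x = 2 *\<^sub>R c - r x" by (simp add: r_def)
      then show ?thesis using that by (auto simp: cross_polytope_def c_def scaleR_2)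
    qed
    ultimately show ?thesis using that by (auto simp: A_def)
  qed
  have bij: "bij_betw r A A"
    by (rule bij_betw_byWitness[where f' = r]) (auto simp: r, auto simp: r_def)
  have sum: "F z summable_on A" for z
    unfolding F_def A_def using summable_gaussian_E8[OF \<alpha>] by (auto intro: summable_on_subset_banach)
  have sumr: "(\<lambda>x. F z (r x)) summable_on A" for z
    using summable_on_reindex_bij_betw[OF bij, of "F z"] sum by simp
  have "infsum (\<lambda>x. 2 * K * F c x) A \<le> infsum (\<lambda>x. F (c + y) x + F (c + y) (r x)) A"
  proof (rule infsum_mono)
    show "(\<lambda>x. 2 * K * F c x) summable_on A" by (intro summable_on_cmult_right sum)
    show "(\<lambda>x. F (c + y) x + F (c + y) (r x)) summable_on A" by (intro summable_on_add sum sumr)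
    fix x
    define s where "s = 2 * \<alpha> * ((x - c) \<bullet> y)"
    have 1: "(norm (x - (c + y)))\<^sup>2 = (norm (x - c))\<^sup>2 + (norm y)\<^sup>2 - 2 * ((x - c) \<bullet> y)"
    proof -
      have "x - (c + y) = (x - c) - y" by simp
      then show ?thesis by (simp only: power2_norm_eq_inner inner_diff_left[of _ y] inner_diff_right[of _ _ y])
        (simp add: inner_commute)
    qed
    have 2: "(norm (r x - (c + y)))\<^sup>2 = (norm (x - c))\<^sup>2 + (norm y)\<^sup>2 + 2 * ((x - c) \<bullet> y)"
    proof -
      have "r x - (c + y) = - ((x - c) + y)" by (simp add: r_def scaleR_2)
      then show ?thesis by (simp only: norm_minus_cancel power2_norm_eq_inner inner_add_left inner_add_right)
        (simp add: inner_commute)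
    qed
    have "F (c + y) x + F (c + y) (r x) = 2 * K * F c x * cosh s"
      unfolding F_def 1 2 K_def s_def cosh_def
      by (simp add: field_simps flip: exp_add)
    moreover have "2 * K * F c x * 1 \<le> 2 * K * F c x * cosh s"
      by (intro mult_left_mono cosh_real_ge_1) (auto simp: K_def F_def)
    ultimately show "2 * K * F c x \<le> F (c + y) x + F (c + y) (r x)" by simp
  qed
  also have "\<dots> = infsum (F (c + y)) A + infsum (\<lambda>x. F (c + y) (r x)) A"
    by (intro infsum_add sum sumr)
  also have "infsum (\<lambda>x. F (c + y) (r x)) A = infsum (F (c + y)) A"
    by (rule infsum_reindex_bij_betw[OF bij])
  finally have "K * infsum (F c) A \<le> infsum (F (c + y)) A"
    by (simp add: infsum_cmult_right')
  then show ?thesis by (simp add: K_def F_def A_def c_def)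
qed

lemma potential_hole:
  assumes "\<alpha> > 0"
  shows "potential (gaussian \<alpha>) E8 (axis 1 1) =
    16 * exp (- \<alpha>) + infsum (\<lambda>x. exp (- \<alpha> * (norm (x - axis 1 1))\<^sup>2)) (E8 - cross_polytope)"
  unfolding potential_split[OF assms] by simp

text \<open>At the displaced point the sixteen vertices contribute \<open>2 * g * C / E\<close> and
  the tail at least \<open>T / E\<close>. After multiplication by \<open>E\<close>, the bound
  \<open>T \<le> 4 * g\<close> reduces the claim to \<open>sum_cosh_gt\<close>.\<close>

lemma potential_near_hole:
  assumes \<alpha>: "\<alpha> \<ge> 23" and y: "y \<noteq> 0" "norm y \<le> 1 / 2"
  shows "potential (gaussian \<alpha>) E8 (axis 1 1) < potential (gaussian \<alpha>) E8 (axis 1 1 + y)"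
proof -
  define E where "E = exp (\<alpha> * (norm y)\<^sup>2)"
  define C where "C = (\<Sum>i\<in>UNIV. cosh (2 * \<alpha> * y $ i))"
  define g where "g = exp (- \<alpha>)"
  define T where "T = infsum (\<lambda>x. exp (- \<alpha> * (norm (x - axis 1 1))\<^sup>2)) (E8 - cross_polytope)"
  have \<alpha>0: "\<alpha> > 0" using \<alpha> by simp
  have E: "E \<ge> 1" using \<alpha>0 by (simp add: E_def)
  have K: "exp (- \<alpha> * (norm y)\<^sup>2) = 1 / E" by (simp add: E_def exp_minus field_simps)
  have "(norm (axis i 1 - y))\<^sup>2 = 1 + (norm y)\<^sup>2 - 2 * y $ i"
       "(norm (axis i 1 + y))\<^sup>2 = 1 + (norm y)\<^sup>2 + 2 * y $ i" for i
    unfolding power2_norm_eq_inner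
    by (simp_all add: inner_diff_left inner_diff_right inner_add_left inner_add_right inner_axis inner_axis')
  moreover have "axis 1 1 - axis i 1 - (axis 1 1 + y) = - (axis i 1 + y)" for i by simp
  ultimately have nn: "(norm (axis 1 1 + axis i 1 - (axis 1 1 + y)))\<^sup>2 = 1 + (norm y)\<^sup>2 - 2 * y $ i"
       "(norm (axis 1 1 - axis i 1 - (axis 1 1 + y)))\<^sup>2 = 1 + (norm y)\<^sup>2 + 2 * y $ i" for i
    by (simp_all only: norm_minus_cancel add_diff_cancel_left)
  have "(\<Sum>i\<in>UNIV. exp (- \<alpha> * (norm (axis 1 1 + axis i 1 - (axis 1 1 + y)))\<^sup>2) +
      exp (- \<alpha> * (norm (axis 1 1 - axis i 1 - (axis 1 1 + y)))\<^sup>2)) =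
      (\<Sum>i\<in>UNIV. 2 * g * (1 / E) * cosh (2 * \<alpha> * y $ i))"
    unfolding nn K[symmetric] g_def cosh_def by (intro sum.cong refl) (simp add: field_simps flip: exp_add)
  also have "\<dots> = 2 * g * C / E" by (simp add: C_def flip: sum_distrib_left sum_divide_distrib)
  finally have sumN: "(\<Sum>i\<in>UNIV. exp (- \<alpha> * (norm (axis 1 1 + axis i 1 - (axis 1 1 + y)))\<^sup>2) +
      exp (- \<alpha> * (norm (axis 1 1 - axis i 1 - (axis 1 1 + y)))\<^sup>2)) = 2 * g * C / E" .
  have "10 * (E - 1) < C - 8" using sum_cosh_gt[OF \<alpha> y] by (simp add: E_def C_def)
  then have "2 * g * (10 * (E - 1)) < 2 * g * (C - 8)" by (intro mult_strict_left_mono) (auto simp: g_def)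
  moreover have "T * (E - 1) \<le> 4 * g * (E - 1)"
    using tail_bound[OF \<alpha>] E by (intro mult_right_mono) (auto simp: T_def g_def)
  ultimately have "(16 * g + T) * E < 2 * g * C + T" by (simp add: algebra_simps)
  then have "16 * g + T < (2 * g * C + T) / E" using E by (simp add: field_simps)
  also have "\<dots> = 2 * g * C / E + 1 / E * T" by (simp add: add_divide_distrib)
  also have "\<dots> \<le> potential (gaussian \<alpha>) E8 (axis 1 1 + y)"
    unfolding potential_split[OF \<alpha>0] sumN using tail_lower[OF \<alpha>0, of y] unfolding K by (simp add: T_def)
  finally show ?thesis unfolding potential_hole[OF \<alpha>0] g_def T_def .
qed

lemma potential_far_hole:
  assumes \<alpha>: "\<alpha> \<ge> 23" and x: "x \<in> E8" "(norm (x - z))\<^sup>2 \<le> 3 / 4"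
  shows "potential (gaussian \<alpha>) E8 (axis 1 1) < potential (gaussian \<alpha>) E8 z"
proof -
  have \<alpha>0: "\<alpha> > 0" using \<alpha> by simp
  \<comment> \<open>The number 20 counts the 16 nearest points plus the 4 from
    \<open>tail_bound\<close>.\<close>
  have "20 < 1 + 23 / 4 + (23 / 4)\<^sup>2 / (2 :: real)" by (simp add: power2_eq_square)
  also have "\<dots> \<le> exp (23 / 4)" by (intro exp_lower_Taylor_quadratic) auto
  also have "\<dots> \<le> exp (\<alpha> / 4)" using \<alpha> by simp
  finally have "20 * exp (- \<alpha>) < exp (\<alpha> / 4) * exp (- \<alpha>)" by simp
  also have "\<dots> = exp (- \<alpha> * (3 / 4))" by (simp add: field_simps flip: exp_add)
  also have "\<dots> \<le> exp (- \<alpha> * (norm (x - z))\<^sup>2)" using x(2) \<alpha>0 by simp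
  also have "\<dots> = (\<Sum>x\<in>{x}. exp (- \<alpha> * (norm (x - z))\<^sup>2))" by simp
  also have "\<dots> \<le> potential (gaussian \<alpha>) E8 z"
    unfolding potential_gaussian using x(1)
    by (intro finite_sum_le_infsum summable_gaussian_E8 \<alpha>0) auto
  finally show ?thesis using tail_bound[OF \<alpha>] unfolding potential_hole[OF \<alpha>0] by linarith
qed

lemma potential_E8_holes:
  "z \<in> E8_holes \<Longrightarrow> potential f E8 z = potential f E8 (axis 1 1)"
  using E8_symmetry_potential[of _ f z] by (force simp: E8_holes_def)

lemma potential_off_E8_holes:
  assumes \<alpha>: "\<alpha> \<ge> 23" and z: "z \<notin> E8_holes"
  shows "potential (gaussian \<alpha>) E8 (axis 1 1) < potential (gaussian \<alpha>) E8 z"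
  using E8_dichotomy[of z]
proof (elim disjE exE bexE conjE)
  fix g assume g: "E8_symmetry g" "norm (g z - axis 1 1) \<le> 1 / 2"
  have "g z - axis 1 1 \<noteq> 0" using z g(1) by (auto simp: E8_holes_def)
  then have "potential (gaussian \<alpha>) E8 (axis 1 1) < potential (gaussian \<alpha>) E8 (axis 1 1 + (g z - axis 1 1))"
    using g(2) \<alpha> by (intro potential_near_hole)
  then show ?thesis using E8_symmetry_potential[OF g(1)] by simp
qed (rule potential_far_hole[OF \<alpha>])

section \<open>Distances to the lattice on and off the holes\<close>

lemma infdist_E8_le_1: "infdist z E8 \<le> 1"
proof -
  obtain x where "x \<in> E8" "norm (z - x) \<le> 1" using E8_covering by blast
  then show ?thesis using infdist_le[of x E8 z] by (simp add: dist_norm)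
qed

lemma infdist_E8_holes:
  assumes "z \<in> E8_holes" shows "infdist z E8 = 1"
proof -
  obtain g where g: "E8_symmetry g" "g z = axis 1 1" using assms by (auto simp: E8_holes_def)
  obtain x where x: "x \<in> E8" "infdist (axis 1 1) E8 = dist (axis 1 1) x"
    using infdist_E8_attained by blast
  have "1 \<le> norm (x - axis 1 1)"
  proof (cases "x \<in> cross_polytope")
    case True
    then show ?thesis by (auto simp: cross_polytope_def)
  next
    case False
    then have "1\<^sup>2 \<le> (norm (x - axis 1 1))\<^sup>2" using norm_sq_ge_off_cross_polytope[OF x(1)] by simp
    then show ?thesis by (rule power2_le_imp_le) simp
  qed
  then have "1 \<le> infdist (axis 1 1) E8" using x by (simp add: dist_norm norm_minus_commute)
  then show ?thesis
    using infdist_E8_le_1[of "axis 1 1"] E8_symmetry_infdist[OF g(1), of z] g(2) by simp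
qed

lemma infdist_off_E8_holes:
  assumes z: "z \<notin> E8_holes" shows "infdist z E8 < 1"
  using E8_dichotomy[of z]
proof (elim disjE exE bexE conjE)
  fix x assume x: "x \<in> E8" "(norm (x - z))\<^sup>2 \<le> 3 / 4"
  then have "(norm (x - z))\<^sup>2 < 1\<^sup>2" by simp
  then have "norm (x - z) < 1" by (rule power2_less_imp_less) simp
  then show ?thesis using infdist_le[OF x(1), of z] by (simp add: dist_norm norm_minus_commute)
next
  fix g assume g: "E8_symmetry g" "norm (g z - axis 1 1) \<le> 1 / 2"
  define y where "y = g z - axis 1 1"
  have y0: "y \<noteq> 0" using z g(1) by (auto simp: E8_holes_def y_def)
  have y4: "(norm y)\<^sup>2 \<le> 1 / 4"
    using power_mono[OF g(2), of 2] by (simp add: y_def power_divide)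
  \<comment> \<open>For such an \<open>i\<close> the vertex on the side of \<open>y $ i\<close> has
    squared distance \<open>(norm y)\<^sup>2 - 2 * \<bar>y $ i\<bar> + 1 < 1\<close>. Otherwise
    \<open>n = (norm y)\<^sup>2\<close> would satisfy \<open>4 * n \<le> 8 * n\<^sup>2\<close>,
    impossible for \<open>0 < n \<le> 1 / 4\<close>.\<close>
  have "\<exists>i. (norm y)\<^sup>2 < 2 * \<bar>y $ i\<bar>"
  proof (rule ccontr)
    assume "\<not> ?thesis"
    then have le: "2 * \<bar>y $ i\<bar> \<le> (norm y)\<^sup>2" for i by (simp add: not_less)
    have "4 * (y $ i)\<^sup>2 \<le> ((norm y)\<^sup>2)\<^sup>2" for i
      using power_mono[OF le[of i], of 2] by (simp add: power_mult_distrib)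
    then have "(\<Sum>i\<in>UNIV. 4 * (y $ i)\<^sup>2) \<le> (\<Sum>i\<in>(UNIV :: 8 set). ((norm y)\<^sup>2)\<^sup>2)" by (intro sum_mono)
    moreover have "(\<Sum>i\<in>UNIV. 4 * (y $ i)\<^sup>2) = 4 * (norm y)\<^sup>2"
      by (simp add: norm_sq_vec sum_distrib_left)
    ultimately have "4 * (norm y)\<^sup>2 \<le> 8 * (norm y)\<^sup>2 * (norm y)\<^sup>2"
      by (simp add: power2_eq_square[of "(norm y)\<^sup>2"])
    also have "\<dots> \<le> 8 * (norm y)\<^sup>2 * (1 / 4)" using y4 by (intro mult_left_mono) auto
    finally show False using y0 by simp
  qed
  then obtain i where i: "(norm y)\<^sup>2 < 2 * \<bar>y $ i\<bar>" by blast
  define s :: real where "s = sgn (y $ i)"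
  have "y $ i \<noteq> 0" using i by auto
  then have s: "s * y $ i = \<bar>y $ i\<bar>" "s * s = 1" "s = 1 \<or> s = -1"
    by (auto simp: s_def sgn_if)
  have E: "axis 1 1 + s *\<^sub>R axis i 1 \<in> E8" using s(3) E8_axis[of 1 i] by auto
  have "(norm (y - s *\<^sub>R axis i 1))\<^sup>2 = (norm y)\<^sup>2 - 2 * (s * y $ i) + s * s"
    unfolding power2_norm_eq_inner
    by (simp add: inner_diff_left inner_diff_right inner_axis inner_axis' algebra_simps)
  also have "\<dots> < 1\<^sup>2" using i s by simp
  finally have "norm (y - s *\<^sub>R axis i 1) < 1" by (rule power2_less_imp_less) simp
  then have "dist (g z) (axis 1 1 + s *\<^sub>R axis i 1) < 1" by (simp add: dist_norm y_def algebra_simps)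
  then have "infdist (g z) E8 < 1" using infdist_le[OF E] by (meson le_less_trans)
  then show ?thesis using E8_symmetry_infdist[OF g(1)] by simp
qed

lemma axis_E8_holes: "axis 1 1 \<in> E8_holes"
  using E8_holes_axis[of 1 1] by simp

theorem theorem3p8:
  fixes \<alpha> :: real
  assumes "\<alpha> \<ge> 23"
  shows "{z. \<forall>w. potential (gaussian \<alpha>) E8 z \<le> potential (gaussian \<alpha>) E8 w} = {c. deep_hole E8 c}"
proof -
  \<comment> \<open>Both sets are identified with \<open>E8_holes\<close>: there the potential is
    constant by symmetry and strictly smaller than elsewhere, while the distance to the lattice is 1
    there and less elsewhere.\<close>
  have "(\<forall>w. potential (gaussian \<alpha>) E8 z \<le> potential (gaussian \<alpha>) E8 w) \<longleftrightarrow> z \<in> E8_holes" for z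
  proof (cases "z \<in> E8_holes")
    case True
    have "potential (gaussian \<alpha>) E8 (axis 1 1) \<le> potential (gaussian \<alpha>) E8 w" for w
      using potential_off_E8_holes[OF assms, of w] potential_E8_holes[of w "gaussian \<alpha>"]
      by (cases "w \<in> E8_holes") auto
    then show ?thesis using True potential_E8_holes[OF True, of "gaussian \<alpha>"] by simp
  next
    case False
    then show ?thesis using potential_off_E8_holes[OF assms False] by (auto simp: not_le)
  qed
  moreover have "deep_hole E8 c \<longleftrightarrow> c \<in> E8_holes" for c
  proof (cases "c \<in> E8_holes")
    case True
    then show ?thesis using infdist_E8_le_1 by (simp add: deep_hole_def infdist_E8_holes)
  next
    case False
    have "infdist c E8 < infdist (axis 1 1) E8"
      using infdist_off_E8_holes[OF False] infdist_E8_holes[OF axis_E8_holes] by simp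
    then show ?thesis using False by (auto simp: deep_hole_def not_le)
  qed
  ultimately show ?thesis by simp
qed

end
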